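(* Every connected abelian Banach-Lie group is natural (as an abstract group). No assumption on the cardinality is made.
   Context: A group $(G,* )$ is called natural if there exists a metric $d$ on the set $G$ such that (i) all right translations $x \mapsto x*a$ ($a \in G$) are isometries of $(G,d)$, and (ii) every group structure $(G,\circ)$ on the same set $G$ for which all right translations $x \mapsto x \circ a$ are isometries of $(G,d)$ is isomorphic as a group to $(G,* )$. A Banach-Lie group is a group that is also a smooth manifold modeled on a real Banach space, with smooth group operations. *)

theory Defs
  imports "HOL-Analysis.Analysis" "HOL-Algebra.Group"
begin

text \<open>Maps that are \<open>n\<close>-linear and bounded; the \<open>n\<close> arguments are given as a list of length
  \<open>n\<close>, and values on lists of any other length are irrelevant.\<close>

definition bounded_multilinear ::
    "nat \<Rightarrow> ('e::real_normed_vector list \<Rightarrow> 'f::real_normed_vector) \<Rightarrow> bool" where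
  "bounded_multilinear n M \<longleftrightarrow>
     (\<forall>vs i. length vs = n \<and> i < n \<longrightarrow> linear (\<lambda>v. M (vs[i := v]))) \<and>
     (\<exists>C. \<forall>vs. length vs = n \<longrightarrow> norm (M vs) \<le> C * prod_list (map norm vs))"

text \<open>\<open>C\<^sup>\<infinity>\<close> in the sense of Frechet. The iterated derivative of order \<open>n\<close> lives in
  \<open>L(E, L(E, \<dots> L(E, F)))\<close>, whose type varies with \<open>n\<close>; we use the usual isometric
  identification with the bounded \<open>n\<close>-linear maps. \<open>D n x\<close> is the \<open>n\<close>-th derivative at \<open>x\<close>, and
  the last clause says that \<open>D (Suc n) x\<close> is the Frechet derivative at \<open>x\<close> of \<open>D n\<close> with
  respect to the operator norm.\<close>

definition smooth_on ::
    "'e::real_normed_vector set \<Rightarrow> ('e \<Rightarrow> 'f::real_normed_vector) \<Rightarrow> bool" where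
  "smooth_on S f \<longleftrightarrow> open S \<and>
     (\<exists>D :: nat \<Rightarrow> 'e \<Rightarrow> 'e list \<Rightarrow> 'f.
        (\<forall>x\<in>S. D 0 x [] = f x) \<and>
        (\<forall>n. \<forall>x\<in>S. bounded_multilinear n (D n x)) \<and>
        (\<forall>n. \<forall>x\<in>S. \<forall>e>0. \<forall>\<^sub>F y in at x. \<forall>vs. length vs = n \<longrightarrow>
            norm (D n y vs - D n x vs - D (Suc n) x ((y - x) # vs))
              \<le> e * norm (y - x) * prod_list (map norm vs)))"

text \<open>A chart is a pair of its domain and its coordinate map; the values of the coordinate map
  outside the domain are irrelevant. Neither second countability nor paracompactness is
  required.\<close>

type_synonym ('a, 'e) chart = "'a set \<times> ('a \<Rightarrow> 'e)"

definition banach_manifold :: "'a topology \<Rightarrow> ('a, 'e::banach) chart set \<Rightarrow> bool" where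
  "banach_manifold T A \<longleftrightarrow>
     Hausdorff_space T \<and>
     (\<Union>(U, \<phi>)\<in>A. U) = topspace T \<and>
     (\<forall>(U, \<phi>)\<in>A. openin T U \<and> open (\<phi> ` U) \<and>
        homeomorphic_map (subtopology T U) (top_of_set (\<phi> ` U)) \<phi>) \<and>
     (\<forall>(U, \<phi>)\<in>A. \<forall>(V, \<psi>)\<in>A. smooth_on (\<phi> ` (U \<inter> V)) (\<psi> \<circ> inv_into U \<phi>))"

definition smooth_map ::
    "'a topology \<Rightarrow> ('a, 'e::banach) chart set \<Rightarrow> 'b topology \<Rightarrow> ('b, 'f::banach) chart set \<Rightarrow>
     ('a \<Rightarrow> 'b) \<Rightarrow> bool" where
  "smooth_map T A T' A' f \<longleftrightarrow>
     continuous_map T T' f \<and>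
     (\<forall>(U, \<phi>)\<in>A. \<forall>(V, \<psi>)\<in>A'. smooth_on (\<phi> ` {x \<in> U. f x \<in> V}) (\<psi> \<circ> f \<circ> inv_into U \<phi>))"

definition prod_atlas ::
    "('a, 'e) chart set \<Rightarrow> ('b, 'f) chart set \<Rightarrow> ('a \<times> 'b, 'e \<times> 'f) chart set" where
  "prod_atlas A B = {(U \<times> V, map_prod \<phi> \<psi>) | U \<phi> V \<psi>. (U, \<phi>) \<in> A \<and> (V, \<psi>) \<in> B}"

definition banach_lie_group ::
    "('a, 'b) monoid_scheme \<Rightarrow> 'a topology \<Rightarrow> ('a, 'e::banach) chart set \<Rightarrow> bool" where
  "banach_lie_group G T A \<longleftrightarrow>
     group G \<and> topspace T = carrier G \<and> banach_manifold T A \<and>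
     smooth_map (prod_topology T T) (prod_atlas A A) T A (\<lambda>(x, y). x \<otimes>\<^bsub>G\<^esub> y) \<and>
     smooth_map T A T A (\<lambda>x. inv\<^bsub>G\<^esub> x)"

definition isometry_of :: "'a set \<Rightarrow> ('a \<Rightarrow> 'a \<Rightarrow> real) \<Rightarrow> ('a \<Rightarrow> 'a) \<Rightarrow> bool" where
  "isometry_of M d f \<longleftrightarrow> bij_betw f M M \<and> (\<forall>x\<in>M. \<forall>y\<in>M. d (f x) (f y) = d x y)"

definition right_translations_isometric ::
    "('a, 'b) monoid_scheme \<Rightarrow> ('a \<Rightarrow> 'a \<Rightarrow> real) \<Rightarrow> bool" where
  "right_translations_isometric G d \<longleftrightarrow>
     (\<forall>a\<in>carrier G. isometry_of (carrier G) d (\<lambda>x. x \<otimes>\<^bsub>G\<^esub> a))"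

definition natural_group :: "('a, 'b) monoid_scheme \<Rightarrow> bool" where
  "natural_group G \<longleftrightarrow> group G \<and>
     (\<exists>d. Metric_space (carrier G) d \<and> right_translations_isometric G d \<and>
        (\<forall>H :: 'a monoid. group H \<and> carrier H = carrier G \<and> right_translations_isometric H d
           \<longrightarrow> H \<cong> G))"

end

theory Submission
  imports Defs "HOL-Algebra.Multiplicative_Group"
begin

text \<open>
The manifold structure is used for one algebraic fact only: the group is divisible. In a chart around
the identity the power map \<open>x \<mapsto> x\<^sup>n\<close> is differentiable with derivative \<open>n\<close> times the identity, so a
contraction argument shows that the \<open>n\<close>-th powers fill a neighbourhood of the identity. As the
group is abelian they form a subgroup, this subgroup is open, and a connected group has no proper
open subgroup (\<open>power_map_in_chart\<close>, \<open>strict_scaling_locally_onto\<close>, \<open>open_subgroup_of_connected\<close>).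

A divisible abelian group is a direct sum of countable infinite subgroups: a maximal independent
family of countable divisible subgroups spans a divisible subgroup, which has a complement, and a
non-trivial complement would contain a further member of the family (\<open>divisible_direct_sum\<close>).

The metric (\<open>coloured_dist\<close>) is defined on such a direct sum, whose index set is given a well-order.
Distances of distinct points lie between \<open>1\<close> and \<open>2\<close>, so the triangle inequality holds whatever
they are, and a distance can serve as one of countably many colours. The distance from \<open>x\<close>
to \<open>y\<close> encodes, up to exchanging \<open>x y\<^sup>-\<^sup>1\<close> with its inverse, the number of non-trivial coordinates of
\<open>x y\<^sup>-\<^sup>1\<close> and the positions of its first and its last non-trivial coordinate in an enumeration of the
summand concerned. The colour does not name the summands, which is why countably many colours
suffice for an index set of any cardinality. Let \<open>g\<close> be an isometry that fixes the identity.

\<^item> Counting non-trivial coordinates is a Hamming distance, so \<open>g\<close> permutes the summands.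
\<^item> Elements with two non-trivial coordinates show which of the two comes first, so the permutation
  preserves the well-order, and therefore it is the identity.
\<^item> On every summand \<open>g\<close> is the identity or the inversion, with the same choice for all summands.
\<^item> The Hamming distances to the elements of the summands determine a point, so this choice
  describes \<open>g\<close> everywhere (\<open>g_id_or_inv\<close>).

Hence every isometry has the form \<open>x \<mapsto> x t\<close> or \<open>x \<mapsto> x\<^sup>-\<^sup>1 t\<close>. Let \<open>\<circ>\<close> be a second group structure whose
right translations are isometries. A map \<open>x \<mapsto> x\<^sup>-\<^sup>1 t\<close> fixes every square root of \<open>t\<close>, and a right
translation with a fixed point is the identity. So all right translations of \<open>\<circ>\<close> are of the first
form, and sending \<open>a\<close> to \<open>1 \<circ> a\<close> is an isomorphism between the two groups (\<open>natural_if_square_roots\<close>).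
\<close>

section \<open>A rigid metric on a direct sum of countable groups\<close>

text \<open>
The summands are given through their coordinate projections: every element has finitely many
non-trivial coordinates and is determined by them. Infinite summands leave enough elements to choose
from when two coordinates have to receive different codes.
\<close>

locale countable_direct_sum = comm_group G for G (structure) +
  fixes I :: "'i set" and r :: "'i rel" and C :: "'i \<Rightarrow> 'a set" and p :: "'i \<Rightarrow> 'a \<Rightarrow> 'a"
  assumes index_order: "well_order_on I r"
    and summand_subgroup: "i \<in> I \<Longrightarrow> subgroup (C i) G"
    and summand_countable: "i \<in> I \<Longrightarrow> countable (C i)"
    and summand_infinite: "i \<in> I \<Longrightarrow> infinite (C i)"
    and proj_hom: "i \<in> I \<Longrightarrow> p i \<in> hom G G"
    and proj_in: "i \<in> I \<Longrightarrow> x \<in> carrier G \<Longrightarrow> p i x \<in> C i"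
    and proj_id: "i \<in> I \<Longrightarrow> u \<in> C i \<Longrightarrow> p i u = u"
    and proj_other: "i \<in> I \<Longrightarrow> j \<in> I \<Longrightarrow> j \<noteq> i \<Longrightarrow> u \<in> C i \<Longrightarrow> p j u = \<one>"
    and finite_support: "x \<in> carrier G \<Longrightarrow> finite {i \<in> I. p i x \<noteq> \<one>}"
    and proj_ext: "x \<in> carrier G \<Longrightarrow> (\<And>i. i \<in> I \<Longrightarrow> p i x = \<one>) \<Longrightarrow> x = \<one>"
begin

definition supp :: "'a \<Rightarrow> 'i set" where
  "supp x = {i \<in> I. p i x \<noteq> \<one>}"

text \<open>For the supports that matter, those with one or two elements, the description has exactly one solution.\<close>

definition lo :: "'i set \<Rightarrow> 'i" where
  "lo S = (THE i. i \<in> S \<and> (\<forall>j\<in>S. (i, j) \<in> r))"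

definition hi :: "'i set \<Rightarrow> 'i" where
  "hi S = (THE i. i \<in> S \<and> (\<forall>j\<in>S. (j, i) \<in> r))"

definition coord_code :: "'i \<Rightarrow> 'a \<Rightarrow> nat" where
  "coord_code i x = to_nat_on (C i) (p i x)"

text \<open>
Together with \<open>lo\<close> and \<open>hi\<close> this records the order of the non-trivial coordinates. For an element with
at most two of them, the support and the shape determine the element.
\<close>

definition shape :: "'a \<Rightarrow> nat \<times> nat \<times> nat" where
  "shape x = (card (supp x), coord_code (lo (supp x)) x, coord_code (hi (supp x)) x)"

text \<open>
The unordered pair of the shapes of \<open>x\<close> and \<open>x\<^sup>-\<^sup>1\<close>: an invariant metric cannot tell these two elements
apart.
\<close>

definition colour :: "'a \<Rightarrow> nat" where
  "colour x = (let a = to_nat (shape x); b = to_nat (shape (inv x)) in to_nat (min a b, max a b))"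

text \<open>Off the identity the values lie between \<open>1\<close> and \<open>2\<close>, and they determine the colour.\<close>

definition length_of :: "'a \<Rightarrow> real" where
  "length_of x = (if x = \<one> then 0 else 1 + 1 / (1 + real (colour x)))"

text \<open>The value \<open>0\<close> outside the carrier keeps the function symmetric and non-negative on the whole type.\<close>

definition coloured_dist :: "'a \<Rightarrow> 'a \<Rightarrow> real" where
  "coloured_dist x y =
     (if x \<in> carrier G \<and> y \<in> carrier G then length_of (x \<otimes> inv y) else 0)"

lemma summand_carrier: "i \<in> I \<Longrightarrow> u \<in> C i \<Longrightarrow> u \<in> carrier G"
  by (rule subgroup.mem_carrier[OF summand_subgroup])

lemma proj_carrier [simp]: "i \<in> I \<Longrightarrow> x \<in> carrier G \<Longrightarrow> p i x \<in> carrier G"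
  by (rule summand_carrier[OF _ proj_in])

lemma proj_mult: "i \<in> I \<Longrightarrow> x \<in> carrier G \<Longrightarrow> y \<in> carrier G \<Longrightarrow> p i (x \<otimes> y) = p i x \<otimes> p i y"
  by (rule hom_mult[OF proj_hom])

lemma proj_inv: "i \<in> I \<Longrightarrow> x \<in> carrier G \<Longrightarrow> p i (inv x) = inv (p i x)"
  by (rule group_hom.hom_inv[OF group_hom.intro[OF is_group is_group group_hom_axioms.intro[OF proj_hom]]])

lemma proj_one [simp]: "i \<in> I \<Longrightarrow> p i \<one> = \<one>"
  by (rule hom_one[OF proj_hom is_group is_group])

lemma supp_one [simp]: "supp \<one> = {}"
  by (auto simp: supp_def)

lemma finite_supp [simp]: "x \<in> carrier G \<Longrightarrow> finite (supp x)"
  unfolding supp_def by (rule finite_support)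

lemma supp_inv [simp]: "x \<in> carrier G \<Longrightarrow> supp (inv x) = supp x"
  by (auto simp: supp_def proj_inv)

lemma inv_mult_inv: "x \<in> carrier G \<Longrightarrow> y \<in> carrier G \<Longrightarrow> inv (x \<otimes> inv y) = y \<otimes> inv x"
  by (simp add: inv_mult_group)

lemma coordinates_eqI:
  assumes "x \<in> carrier G" "y \<in> carrier G" "\<And>i. i \<in> I \<Longrightarrow> p i x = p i y"
  shows "x = y"
proof -
  have "x \<otimes> inv y = \<one>"
  proof (rule proj_ext)
    show "p i (x \<otimes> inv y) = \<one>" if "i \<in> I" for i
      using assms that by (simp add: proj_mult proj_inv)
  qed (use assms in simp)
  then show ?thesis
    using assms inv_equality[of x "inv y"] by auto
qed

lemma index_refl: "i \<in> I \<Longrightarrow> (i, i) \<in> r"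
  using index_order unfolding well_order_on_def linear_order_on_def partial_order_on_def
    preorder_on_def refl_on_def by blast

lemma index_antisym: "(i, j) \<in> r \<Longrightarrow> (j, i) \<in> r \<Longrightarrow> i = j"
  using index_order unfolding well_order_on_def linear_order_on_def partial_order_on_def
    antisym_def by blast

lemma index_total: "i \<in> I \<Longrightarrow> j \<in> I \<Longrightarrow> (i, j) \<in> r \<or> (j, i) \<in> r"
  using index_order index_refl[of i] unfolding well_order_on_def linear_order_on_def total_on_def
  by (cases "i = j") simp_all

lemma lo_pair: "i \<in> I \<Longrightarrow> (i, j) \<in> r \<Longrightarrow> lo {i, j} = i"
  unfolding lo_def by (rule the_equality) (auto intro: index_refl index_antisym)

lemma hi_pair: "j \<in> I \<Longrightarrow> (i, j) \<in> r \<Longrightarrow> hi {i, j} = j"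
  unfolding hi_def by (rule the_equality) (auto intro: index_refl index_antisym)

lemma coord_code_eq:
  assumes "i \<in> I" "x \<in> carrier G" "y \<in> carrier G"
  shows "coord_code i x = coord_code i y \<longleftrightarrow> p i x = p i y"
  using assms summand_countable[of i] proj_in[of i]
  by (simp add: coord_code_def)

text \<open>An unordered pair is recovered from its minimum and its maximum.\<close>

lemma length_of_eq:
  assumes "length_of x = length_of y" "x \<in> carrier G" "y \<in> carrier G"
  shows "shape x = shape y \<or> shape x = shape (inv y)"
proof (cases "x = \<one> \<or> y = \<one>")
  case True
  have "length_of z \<noteq> 0" if "z \<noteq> \<one>" for z
    using that by (simp add: length_of_def add_pos_pos less_imp_neq[symmetric])
  then show ?thesis using True assms(1) by (metis length_of_def)
next
  case False
  then have "colour x = colour y"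
    using assms(1) by (simp add: length_of_def field_simps)
  then have "min (to_nat (shape x)) (to_nat (shape (inv x))) = min (to_nat (shape y)) (to_nat (shape (inv y)))"
     "max (to_nat (shape x)) (to_nat (shape (inv x))) = max (to_nat (shape y)) (to_nat (shape (inv y)))"
    by (auto simp: colour_def Let_def)
  then have "to_nat (shape x) = to_nat (shape y) \<or> to_nat (shape x) = to_nat (shape (inv y))"
    by (auto simp: min_def max_def split: if_splits)
  then show ?thesis by simp
qed

lemma card_supp_eq:
  assumes "length_of x = length_of y" "x \<in> carrier G" "y \<in> carrier G"
  shows "card (supp x) = card (supp y)"
  using length_of_eq[OF assms] assms by (auto simp: shape_def)

lemma length_of_inv: "x \<in> carrier G \<Longrightarrow> length_of (inv x) = length_of x"
  by (simp add: length_of_def colour_def Let_def min.commute max.commute)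

lemma length_of_bounds: "x \<noteq> \<one> \<Longrightarrow> 1 \<le> length_of x \<and> length_of x \<le> 2"
  by (auto simp: length_of_def field_simps)

lemma mult_inv_eq_one:
  assumes "x \<in> carrier G" "y \<in> carrier G"
  shows "x \<otimes> inv y = \<one> \<longleftrightarrow> x = y"
  using assms inv_equality[of x "inv y"] by auto

text \<open>Any symmetric function with values between \<open>1\<close> and \<open>2\<close> off the diagonal satisfies the triangle inequality.\<close>

lemma Metric_space_coloured_dist: "Metric_space (carrier G) coloured_dist"
proof -
  have db: "1 \<le> coloured_dist x y \<and> coloured_dist x y \<le> 2"
    if "x \<in> carrier G" "y \<in> carrier G" "x \<noteq> y" for x y
    using that length_of_bounds[of "x \<otimes> inv y"] by (simp add: coloured_dist_def mult_inv_eq_one)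
  have d0: "coloured_dist x y = 0 \<longleftrightarrow> x = y" if "x \<in> carrier G" "y \<in> carrier G" for x y
    using that db[of x y] by (cases "x = y") (auto simp: coloured_dist_def length_of_def)
  show ?thesis
  proof
    show "0 \<le> coloured_dist x y" for x y
      by (simp add: coloured_dist_def length_of_def)
    show "coloured_dist x y = coloured_dist y x" for x y
      using length_of_inv[of "x \<otimes> inv y"] by (auto simp: coloured_dist_def inv_mult_inv)
    show "coloured_dist x y = 0 \<longleftrightarrow> x = y" if "x \<in> carrier G" "y \<in> carrier G" for x y
      by (rule d0[OF that])
    show "coloured_dist x z \<le> coloured_dist x y + coloured_dist y z"
      if "x \<in> carrier G" "y \<in> carrier G" "z \<in> carrier G" for x y z
    proof (cases "x = y \<or> y = z \<or> x = z")
      case True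
      then show ?thesis using that d0[of x x] d0[of y y]
        by (auto simp: coloured_dist_def length_of_def)
    next
      case False
      then show ?thesis using that db[of x y] db[of y z] db[of x z] by auto
    qed
  qed
qed

lemma right_translations_coloured_dist: "right_translations_isometric G coloured_dist"
  unfolding right_translations_isometric_def isometry_of_def
proof (intro ballI conjI)
  fix a assume a: "a \<in> carrier G"
  show "bij_betw (\<lambda>x. x \<otimes> a) (carrier G) (carrier G)"
    by (rule bij_betw_byWitness[of _ "\<lambda>x. x \<otimes> inv a"]) (use a in \<open>auto simp: m_assoc\<close>)
  fix x y assume xy: "x \<in> carrier G" "y \<in> carrier G"
  have "x \<otimes> a \<otimes> inv (y \<otimes> a) = x \<otimes> (a \<otimes> inv a) \<otimes> inv y"
    by (simp only: inv_mult_group m_assoc m_closed inv_closed a xy)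
  then show "coloured_dist (x \<otimes> a) (y \<otimes> a) = coloured_dist x y"
    using a xy by (simp add: coloured_dist_def)
qed

text \<open>
A support with at most two elements consists of its two extreme indices, so the shape records all
non-trivial coordinates.
\<close>

lemma small_support_determined:
  assumes eq: "length_of x = length_of y" and xy: "x \<in> carrier G" "y \<in> carrier G"
    and sub: "supp x \<subseteq> {i, j}" and same: "supp x = supp y"
  shows "x = y \<or> x = inv y"
proof -
  have lh: "k = lo (supp x) \<or> k = hi (supp x)" if k: "k \<in> supp x" for k
  proof -
    have in_I: "l \<in> I" if "l \<in> supp x" for l
      using that by (simp add: supp_def)
    have "supp x = {k} \<or> (\<exists>l. supp x = {k, l})"
      using sub k by (cases "k = i") auto
    then obtain l where l: "supp x = {k, l}" by (metis insert_absorb2)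
    then have kl: "k \<in> I" "l \<in> I" using in_I by auto
    from index_total[OF kl] show ?thesis
      using kl l lo_pair hi_pair by (metis insert_commute)
  qed
  have det: "x = z" if cxz: "shape x = shape z" and z: "z \<in> carrier G" and szx: "supp z = supp x" for z
  proof (rule coordinates_eqI[OF xy(1) z])
    fix k assume k: "k \<in> I"
    show "p k x = p k z"
    proof (cases "k \<in> supp x")
      case True
      then have "coord_code k x = coord_code k z"
        using lh[OF True] cxz szx by (auto simp: shape_def)
      then show ?thesis using coord_code_eq k xy z by blast
    next
      case False
      then have "p k x = \<one>" "p k z = \<one>"
        using k szx unfolding supp_def by blast+
      then show ?thesis by simp
    qed
  qed
  show ?thesis
    using length_of_eq[OF eq xy] det[of y] det[of "inv y"] xy same by auto
qed

lemma summand_one: "i \<in> I \<Longrightarrow> \<one> \<in> C i"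
  by (rule subgroup.one_closed[OF summand_subgroup])

lemma summand_inv: "i \<in> I \<Longrightarrow> u \<in> C i \<Longrightarrow> inv u \<in> C i"
  by (rule subgroup.m_inv_closed[OF summand_subgroup])

lemma summand_diff: "i \<in> I \<Longrightarrow> u \<in> C i \<Longrightarrow> v \<in> C i \<Longrightarrow> u \<otimes> inv v \<in> C i"
  by (intro subgroup.m_closed[OF summand_subgroup] summand_inv)

lemma proj_summand: "i \<in> I \<Longrightarrow> j \<in> I \<Longrightarrow> u \<in> C i \<Longrightarrow> p j u = (if j = i then u else \<one>)"
  by (simp add: proj_id proj_other)

lemma supp_summand: "i \<in> I \<Longrightarrow> u \<in> C i \<Longrightarrow> supp u = (if u = \<one> then {} else {i})"
  by (auto simp: supp_def proj_summand split: if_splits)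

lemma supp_singleton: 
  assumes x: "x \<in> carrier G" and s: "supp x = {i}"
  shows "i \<in> I" "x \<in> C i" "x \<noteq> \<one>"
proof -
  show i: "i \<in> I" using s by (auto simp: supp_def)
  have pi: "p i x \<in> C i" by (rule proj_in[OF i x])
  have "x = p i x"
  proof (rule coordinates_eqI)
    fix j assume j: "j \<in> I"
    show "p j x = p j (p i x)"
      using s j unfolding supp_def by (simp add: proj_summand[OF i j pi]) blast
  qed (use x i in auto)
  then show "x \<in> C i" using pi by simp
  show "x \<noteq> \<one>" using s by auto
qed

lemma supp_diff_pair:
  assumes "i \<in> I" "j \<in> I" "i \<noteq> j" "u \<in> C i" "v \<in> C j" "u \<noteq> \<one>" "v \<noteq> \<one>"
  shows "supp (u \<otimes> inv v) = {i, j}"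
proof -
  have uv: "u \<in> carrier G" "v \<in> carrier G" using assms summand_carrier by auto
  have "p k (u \<otimes> inv v) = (if k = i then u else if k = j then inv v else \<one>)" if "k \<in> I" for k
    using that assms uv by (simp add: proj_mult proj_inv proj_summand)
  then show ?thesis using assms uv by (auto simp: supp_def split: if_splits)
qed

lemma supp_subset_proj: "x \<in> carrier G \<Longrightarrow> i \<in> supp x \<Longrightarrow> supp (x \<otimes> inv (p i x)) = supp x - {i}"
proof -
  assume x: "x \<in> carrier G" and i: "i \<in> supp x"
  then have iI: "i \<in> I" by (simp add: supp_def)
  have "p j (x \<otimes> inv (p i x)) = (if j = i then \<one> else p j x)" if "j \<in> I" for j
    using that x iI by (simp add: proj_mult proj_inv proj_summand[OF iI that proj_in[OF iI x]])
  then show ?thesis by (auto simp: supp_def split: if_splits)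
qed

lemma summand_nontrivial: "i \<in> I \<Longrightarrow> \<exists>u\<in>C i. u \<noteq> \<one>"
  using summand_infinite by (metis finite.emptyI finite_insert finite_subset singletonI subsetI)

end

text \<open>
At a least index that is moved, the image cannot be smaller, by injectivity; it cannot be larger
either, since then nothing could be mapped to that index.
\<close>

lemma well_order_automorphism_id:
  assumes wo: "well_order_on I r" and bij: "bij_betw \<sigma> I I"
    and mono: "\<And>i j. i \<in> I \<Longrightarrow> j \<in> I \<Longrightarrow> i \<noteq> j \<Longrightarrow> (i, j) \<in> r \<Longrightarrow> (\<sigma> i, \<sigma> j) \<in> r"
    and i: "i \<in> I"
  shows "\<sigma> i = i"
proof -
  have wf: "wf (r - Id)" and lin: "linear_order_on I r"
    using wo by (auto simp: well_order_on_def)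
  have anti: "x = y" if "(x, y) \<in> r" "(y, x) \<in> r" for x y
    using lin that unfolding linear_order_on_def partial_order_on_def antisym_def by blast
  have tot: "(x, y) \<in> r \<or> (y, x) \<in> r" if "x \<in> I" "y \<in> I" "x \<noteq> y" for x y
    using lin that by (simp add: linear_order_on_def total_on_def)
  have inj: "x = y" if "\<sigma> x = \<sigma> y" "x \<in> I" "y \<in> I" for x y
    using bij that by (auto simp: bij_betw_def inj_on_def)
  have cl: "\<sigma> x \<in> I" if "x \<in> I" for x
    using bij that by (auto simp: bij_betw_def)
  show ?thesis using i
  proof (induction i rule: wf_induct_rule[OF wf])
    case (1 i)
    show ?case
    proof (rule ccontr)
      assume ne: "\<sigma> i \<noteq> i"
      then have "(\<sigma> i, i) \<in> r \<or> (i, \<sigma> i) \<in> r" using tot 1 cl by blast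
      then show False
      proof
        assume "(\<sigma> i, i) \<in> r"
        then have "\<sigma> (\<sigma> i) = \<sigma> i" using 1 ne cl by simp
        then show False using inj ne 1(2) cl by blast
      next
        assume less: "(i, \<sigma> i) \<in> r"
        obtain k where k: "k \<in> I" "\<sigma> k = i"
          using bij 1(2) unfolding bij_betw_def by (metis imageE)
        have ki: "k \<noteq> i" using k ne by auto
        from tot[OF k(1) 1(2) ki] show False
        proof
          assume "(k, i) \<in> r"
          then show False using 1(1)[of k] ki k by simp
        next
          assume "(i, k) \<in> r"
          then have "(\<sigma> i, i) \<in> r" using mono[of i k] 1(2) k ki by simp
          then show False using anti less ne by blast
        qed
      qed
    qed
  qed
qed

context countable_direct_sum begin

text \<open>
Used to choose an element of one summand whose codes differ from those of a given element of another
summand, so that a first coordinate cannot be mistaken for a last one.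
\<close>

lemma coord_code_avoiding:
  assumes i: "i \<in> I" and X: "finite X"
  shows "\<exists>u\<in>C i. u \<noteq> \<one> \<and> coord_code i u \<notin> X \<and> coord_code i (inv u) \<notin> X"
proof -
  let ?B = "{u \<in> C i. coord_code i u \<in> X}"
  have "inj_on (coord_code i) (C i)"
    using i by (auto intro!: inj_onI simp: coord_code_eq summand_carrier proj_summand)
  then have "finite (coord_code i -` X \<inter> C i)" by (rule finite_vimage_IntI[OF X])
  moreover have "?B = coord_code i -` X \<inter> C i" by blast
  ultimately have "finite ?B" by simp
  then have "finite (insert \<one> (?B \<union> (\<lambda>u. inv u) ` ?B))" by blast
  with summand_infinite[OF i] have "\<not> C i \<subseteq> insert \<one> (?B \<union> (\<lambda>u. inv u) ` ?B)"
    using finite_subset by blast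
  then obtain u where u: "u \<in> C i" "u \<noteq> \<one>" "u \<notin> ?B" "u \<notin> (\<lambda>u. inv u) ` ?B" by blast
  have "inv u \<notin> ?B"
  proof
    assume "inv u \<in> ?B"
    then have "inv (inv u) \<in> (\<lambda>u. inv u) ` ?B" by (rule imageI)
    then show False using u summand_carrier[OF i u(1)] by simp
  qed
  then show ?thesis using u summand_inv[OF i u(1)] by blast
qed

end

text \<open>Up to a right translation, every isometry fixes the identity.\<close>

locale rooted_isometry = countable_direct_sum +
  fixes g :: "'a \<Rightarrow> 'a"
  assumes isometry: "isometry_of (carrier G) coloured_dist g"
    and root: "g \<one> = \<one>"
begin

lemma g_bij: "bij_betw g (carrier G) (carrier G)"
  using isometry by (simp add: isometry_of_def)

lemma g_carrier [simp]: "x \<in> carrier G \<Longrightarrow> g x \<in> carrier G"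
  using g_bij by (auto simp: bij_betw_def)

lemma g_length_diff:
  "x \<in> carrier G \<Longrightarrow> y \<in> carrier G \<Longrightarrow> length_of (g x \<otimes> inv (g y)) = length_of (x \<otimes> inv y)"
  using isometry by (simp add: isometry_of_def coloured_dist_def)

lemma g_length: "x \<in> carrier G \<Longrightarrow> length_of (g x) = length_of x"
  using g_length_diff[of x \<one>] by (simp add: root)

lemma g_card_diff:
  assumes "x \<in> carrier G" "y \<in> carrier G"
  shows "card (supp (g x \<otimes> inv (g y))) = card (supp (x \<otimes> inv y))"
  using assms by (intro card_supp_eq g_length_diff) auto

lemma g_card: "x \<in> carrier G \<Longrightarrow> card (supp (g x)) = card (supp x)"
  by (intro card_supp_eq g_length) auto

lemma g_eq_one_iff: "x \<in> carrier G \<Longrightarrow> g x = \<one> \<longleftrightarrow> x = \<one>"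
  using g_bij root unfolding bij_betw_def inj_on_def by (metis one_closed)

text \<open>
Elements with exactly one non-trivial coordinate go to such elements, since the colour contains the
number of non-trivial coordinates. Two of them belong to the same summand if and only if their
quotient has at most one non-trivial coordinate, and this is visible in the distance.
\<close>

lemma g_permutes_summands:
  "\<exists>\<sigma>. bij_betw \<sigma> I I \<and> (\<forall>i\<in>I. \<forall>u\<in>C i. g u \<in> C (\<sigma> i))"
proof -
  obtain e where e: "\<And>i. i \<in> I \<Longrightarrow> e i \<in> C i" "\<And>i. i \<in> I \<Longrightarrow> e i \<noteq> \<one>"
    using summand_nontrivial by metis
  have e_carr: "e i \<in> carrier G" if "i \<in> I" for i
    using e that summand_carrier by blast
  have single: "\<exists>k. supp (g u) = {k}" if "i \<in> I" "u \<in> C i" "u \<noteq> \<one>" for i u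
  proof -
    have "card (supp (g u)) = 1"
      using that summand_carrier[OF that(1,2)] by (simp add: g_card supp_summand)
    then show ?thesis by (rule card_1_singletonE) blast
  qed
  \<comment> \<open>The summand that contains the image of the chosen element \<open>e i\<close>.\<close>
  define \<sigma> where "\<sigma> i = (THE k. supp (g (e i)) = {k})" for i
  have \<sigma>: "supp (g (e i)) = {\<sigma> i}" if "i \<in> I" for i
    using single[OF that e[OF that]] unfolding \<sigma>_def by auto
  have \<sigma>_I: "\<sigma> i \<in> I" and g_e: "g (e i) \<in> C (\<sigma> i)" "g (e i) \<noteq> \<one>" if "i \<in> I" for i
    using supp_singleton[OF g_carrier[OF e_carr[OF that]] \<sigma>[OF that]] by auto
  have maps: "g u \<in> C (\<sigma> i)" if i: "i \<in> I" and u: "u \<in> C i" for i u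
  proof (cases "u = \<one>")
    case True
    then show ?thesis using root summand_one \<sigma>_I i by simp
  next
    case False
    have uc: "u \<in> carrier G" using i u summand_carrier by blast
    obtain k where k: "supp (g u) = {k}" using single[OF i u False] by blast
    have gu: "k \<in> I" "g u \<in> C k" "g u \<noteq> \<one>"
      using supp_singleton[OF g_carrier[OF uc] k] by auto
    have "k = \<sigma> i"
    proof (rule ccontr)
      assume ne: "k \<noteq> \<sigma> i"
      have "card (supp (g u \<otimes> inv (g (e i)))) = 2"
        using supp_diff_pair[OF gu(1) \<sigma>_I[OF i] ne gu(2) g_e(1)[OF i] gu(3) g_e(2)[OF i]] ne by simp
      moreover have "card (supp (u \<otimes> inv (e i))) \<le> 1"
        using supp_summand[OF i summand_diff[OF i u e(1)[OF i]]] by simp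
      ultimately show False using g_card_diff[OF uc e_carr[OF i]] by simp
    qed
    then show ?thesis using gu by simp
  qed
  have "inj_on \<sigma> I"
  proof (rule inj_onI, rule ccontr)
    fix i j assume ij: "i \<in> I" "j \<in> I" and eq: "\<sigma> i = \<sigma> j" and ne: "i \<noteq> j"
    have "card (supp (e i \<otimes> inv (e j))) = 2"
      using supp_diff_pair[OF ij ne e(1)[OF ij(1)] e(1)[OF ij(2)] e(2)[OF ij(1)] e(2)[OF ij(2)]] ne by simp
    moreover have "g (e i) \<otimes> inv (g (e j)) \<in> C (\<sigma> i)"
      using g_e[OF ij(1)] g_e[OF ij(2)] eq \<sigma>_I ij by (simp add: summand_diff)
    then have "card (supp (g (e i) \<otimes> inv (g (e j)))) \<le> 1"
      using supp_summand[OF \<sigma>_I[OF ij(1)]] by simp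
    ultimately show False using g_card_diff[OF e_carr[OF ij(1)] e_carr[OF ij(2)]] by simp
  qed
  moreover have "k \<in> \<sigma> ` I" if k: "k \<in> I" for k
  proof -
    obtain x where x: "x \<in> carrier G" "g x = e k"
      using g_bij e_carr[OF k] unfolding bij_betw_def by (metis imageE)
    have "card (supp x) = 1"
      using g_card[OF x(1)] supp_summand[OF k e(1)[OF k]] e(2)[OF k] x(2) by simp
    then obtain i where i: "supp x = {i}" by (rule card_1_singletonE)
    have "i \<in> I" "e k \<in> C (\<sigma> i)"
      using supp_singleton[OF x(1) i] maps[of i x] x(2) by auto
    then have "{k} = {\<sigma> i}"
      using supp_summand[OF k e(1)[OF k]] supp_summand[OF \<sigma>_I, of i "e k"] e(2)[OF k] by simp
    then show ?thesis using \<open>i \<in> I\<close> by blast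
  qed
  ultimately have "bij_betw \<sigma> I I"
    using \<sigma>_I by (auto simp: bij_betw_def)
  then show ?thesis using maps by blast
qed

lemma shape_diff_pair:
  assumes ij: "i \<in> I" "j \<in> I" "i \<noteq> j" "(i, j) \<in> r" and u: "u \<in> C i" "v \<in> C j" "u \<noteq> \<one>" "v \<noteq> \<one>"
  shows "shape (u \<otimes> inv v) = (2, coord_code i u, coord_code j (inv v))"
    and "shape (v \<otimes> inv u) = (2, coord_code i (inv u), coord_code j v)"
proof -
  have uv: "u \<in> carrier G" "v \<in> carrier G" using assms summand_carrier by auto
  have 1: "supp (u \<otimes> inv v) = {i, j}" by (rule supp_diff_pair) (use assms in auto)
  have 2: "supp (v \<otimes> inv u) = {i, j}" using supp_diff_pair[of j i v u] assms by auto
  have "p i (u \<otimes> inv v) = p i u" "p j (u \<otimes> inv v) = p j (inv v)"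
     "p j (v \<otimes> inv u) = p j v" "p i (v \<otimes> inv u) = p i (inv u)"
    using assms uv by (simp_all add: proj_mult proj_inv proj_summand[of i i] proj_summand[of j j] 
        proj_summand[of i j] proj_summand[of j i])
  then show "shape (u \<otimes> inv v) = (2, coord_code i u, coord_code j (inv v))"
    "shape (v \<otimes> inv u) = (2, coord_code i (inv u), coord_code j v)"
    unfolding shape_def 1 2 lo_pair[OF ij(1,4)] hi_pair[OF ij(2,4)]
    using ij by (simp_all add: coord_code_def)
qed

lemma shape_summand:
  assumes "i \<in> I" "u \<in> C i" "u \<noteq> \<one>"
  shows "shape u = (1, coord_code i u, coord_code i u)"
  using assms lo_pair[of i i] hi_pair[of i i] index_refl[of i] by (simp add: shape_def supp_summand)

text \<open>
Take \<open>u\<close> and \<open>v\<close> from the summands of \<open>i\<close> and \<open>j\<close>. If the order were reversed, then the first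
coordinate of \<open>g u (g v)\<^sup>-\<^sup>1\<close> would come from \<open>g v\<close>, whose codes are those of \<open>v\<close> up to inversion,
whereas the distance of \<open>u\<close> and \<open>v\<close> says that it is a code of \<open>u\<close> or \<open>u\<^sup>-\<^sup>1\<close>. A suitable \<open>v\<close> has no
code in common with \<open>u\<close>.
\<close>

lemma g_order_preserving:
  assumes \<sigma>: "bij_betw \<sigma> I I" and maps: "\<And>i u. i \<in> I \<Longrightarrow> u \<in> C i \<Longrightarrow> g u \<in> C (\<sigma> i)"
    and ij: "i \<in> I" "j \<in> I" "i \<noteq> j" "(i, j) \<in> r"
  shows "(\<sigma> i, \<sigma> j) \<in> r"
proof (rule ccontr)
  assume neg: "(\<sigma> i, \<sigma> j) \<notin> r"
  have \<sigma>_I: "\<sigma> i \<in> I" "\<sigma> j \<in> I" using \<sigma> ij by (auto simp: bij_betw_def)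
  have ne: "\<sigma> j \<noteq> \<sigma> i" using \<sigma> ij by (auto simp: bij_betw_def inj_on_def)
  have rev: "(\<sigma> j, \<sigma> i) \<in> r" using neg index_total[OF \<sigma>_I] by blast
  obtain u where u: "u \<in> C i" "u \<noteq> \<one>" using summand_nontrivial[OF ij(1)] by blast
  obtain v where v: "v \<in> C j" "v \<noteq> \<one>"
    and v': "coord_code j v \<notin> {coord_code i u, coord_code i (inv u)}"
            "coord_code j (inv v) \<notin> {coord_code i u, coord_code i (inv u)}"
    using coord_code_avoiding[OF ij(2), of "{coord_code i u, coord_code i (inv u)}"] by auto
  have uc: "u \<in> carrier G" and vc: "v \<in> carrier G"
    using u v ij summand_carrier by auto
  have gu: "g u \<in> C (\<sigma> i)" "g u \<noteq> \<one>" and gv: "g v \<in> C (\<sigma> j)" "g v \<noteq> \<one>"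
    using maps ij u v g_eq_one_iff uc vc by auto
  have "shape (g u \<otimes> inv (g v)) = shape (u \<otimes> inv v) \<or> shape (g u \<otimes> inv (g v)) = shape (inv (u \<otimes> inv v))"
    using uc vc by (intro length_of_eq g_length_diff) auto
  then have 1: "coord_code (\<sigma> j) (inv (g v)) \<in> {coord_code i u, coord_code i (inv u)}"
    using shape_diff_pair[OF ij u(1) v(1) u(2) v(2)] inv_mult_inv[OF uc vc]
      shape_diff_pair(2)[OF \<sigma>_I(2,1) ne rev gv(1) gu(1) gv(2) gu(2)] by auto
  have "shape (inv (g v)) = shape v \<or> shape (inv (g v)) = shape (inv v)"
    using vc by (intro length_of_eq) (auto simp: length_of_inv g_length)
  moreover have "shape (inv (g v)) = (1, coord_code (\<sigma> j) (inv (g v)), coord_code (\<sigma> j) (inv (g v)))"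
    using gv \<sigma>_I vc by (intro shape_summand summand_inv) (auto simp: inv_eq_1_iff)
  moreover have "shape v = (1, coord_code j v, coord_code j v)"
    "shape (inv v) = (1, coord_code j (inv v), coord_code j (inv v))"
    using v ij vc by (rule_tac [1-2] shape_summand) (auto simp: summand_inv inv_eq_1_iff)
  ultimately have "coord_code (\<sigma> j) (inv (g v)) \<in> {coord_code j v, coord_code j (inv v)}" by auto
  then show False using 1 v' by auto
qed

lemma g_preserves_summands:
  assumes "i \<in> I" "u \<in> C i"
  shows "g u \<in> C i"
proof -
  obtain \<sigma> where \<sigma>: "bij_betw \<sigma> I I" and maps: "\<forall>i\<in>I. \<forall>u\<in>C i. g u \<in> C (\<sigma> i)"
    using g_permutes_summands by blast
  have "\<sigma> i = i"
    using index_order \<sigma> g_order_preserving[OF \<sigma>] maps assms(1)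
    by (intro well_order_automorphism_id[of I r \<sigma>]) auto
  then show ?thesis using maps assms by auto
qed

lemma g_summand_sign:
  assumes "i \<in> I" "u \<in> C i"
  shows "g u = u \<or> g u = inv u"
proof (rule small_support_determined)
  have "u \<in> carrier G" using assms summand_carrier by blast
  then show "length_of (g u) = length_of u" "u \<in> carrier G" "g u \<in> carrier G" by (auto simp: g_length)
  show "supp (g u) \<subseteq> {i, i}" "supp (g u) = supp u"
    using assms g_preserves_summands[OF assms] g_eq_one_iff[OF \<open>u \<in> carrier G\<close>]
    by (auto simp: supp_summand split: if_splits)
qed

text \<open>
If \<open>g\<close> inverts \<open>u\<close> and fixes \<open>v\<close>, then \<open>u\<^sup>-\<^sup>1 v\<^sup>-\<^sup>1\<close> and \<open>u v\<^sup>-\<^sup>1\<close> have the same colour and at most two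
non-trivial coordinates, so they are equal or inverse to each other. In the first case \<open>u\<close> is its own
inverse, in the second case \<open>v\<close> is.
\<close>

lemma g_global_sign:
  "(\<forall>i\<in>I. \<forall>u\<in>C i. g u = u) \<or> (\<forall>i\<in>I. \<forall>u\<in>C i. g u = inv u)"
proof (rule ccontr)
  assume "\<not> ?thesis"
  then obtain i j u v where ij: "i \<in> I" "j \<in> I" and uv: "u \<in> C i" "v \<in> C j"
    and neq: "g u \<noteq> u" "g v \<noteq> inv v" by blast
  have gu: "g u = inv u" and gv: "g v = v"
    using g_summand_sign ij uv neq by auto
  have c: "u \<in> carrier G" "v \<in> carrier G" using ij uv summand_carrier by auto
  have ne1: "u \<noteq> \<one>" "v \<noteq> \<one>" using neq gu gv by auto
  have size: "length_of (inv u \<otimes> inv v) = length_of (u \<otimes> inv v)"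
    using g_length_diff[OF c] gu gv by simp
  have supps: "supp (inv u \<otimes> inv v) = supp (u \<otimes> inv v)" "supp (u \<otimes> inv v) \<subseteq> {i, j}"
  proof -
    have eq: "supp (inv u \<otimes> inv v) = supp (u \<otimes> inv v) \<and> supp (u \<otimes> inv v) \<subseteq> {i, j}"
    proof (cases "i = j")
      case True
      have "u \<otimes> inv v \<in> C i" "inv u \<otimes> inv v \<in> C i"
        using uv ij True by (auto intro: summand_diff summand_inv)
      then show ?thesis
        using card_supp_eq[OF size] c ij(1) by (auto simp: supp_summand split: if_splits)
    next
      case False
      then show ?thesis
        using supp_diff_pair[OF ij False uv ne1] c ne1
          supp_diff_pair[OF ij False summand_inv[OF ij(1) uv(1)] uv(2) _ ne1(2)]
        by (auto simp: inv_eq_1_iff)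
    qed
    then show "supp (inv u \<otimes> inv v) = supp (u \<otimes> inv v)" "supp (u \<otimes> inv v) \<subseteq> {i, j}" by auto
  qed
  have "inv u \<otimes> inv v = u \<otimes> inv v \<or> inv u \<otimes> inv v = inv (u \<otimes> inv v)"
    using size c supps by (intro small_support_determined[of _ _ i j]) auto
  then show False
  proof
    assume "inv u \<otimes> inv v = u \<otimes> inv v"
    then have "inv u = u" using c by simp
    then show False using gu neq by simp
  next
    assume "inv u \<otimes> inv v = inv (u \<otimes> inv v)"
    also have "\<dots> = inv u \<otimes> v" using c by (simp add: inv_mult_inv m_comm)
    finally have "inv v = v" using c by simp
    then show False using gv neq by simp
  qed
qed

end

context countable_direct_sum begin

text \<open>
Dividing \<open>x\<close> by an element \<open>u\<close> of a summand decreases the number of non-trivial coordinates exactly if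
\<open>u\<close> is a non-trivial coordinate of \<open>x\<close>, so these numbers reveal all coordinates.
\<close>

lemma determined_by_summand_distances:
  assumes x: "x \<in> carrier G" and y: "y \<in> carrier G"
    and card: "card (supp y) = card (supp x)"
    and dist: "\<And>i u. i \<in> I \<Longrightarrow> u \<in> C i \<Longrightarrow> card (supp (y \<otimes> inv u)) = card (supp (x \<otimes> inv u))"
  shows "y = x"
proof -
  have agree: "i \<in> supp y \<and> p i y = p i x" if i: "i \<in> supp x" for i
  proof -
    have iI: "i \<in> I" using i by (simp add: supp_def)
    let ?u = "p i x"
    have uC: "?u \<in> C i" and uc: "?u \<in> carrier G" using iI x proj_in by auto
    have "card (supp (y \<otimes> inv ?u)) = card (supp x - {i})"
      using dist[OF iI uC] supp_subset_proj[OF x i] by simp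
    also have "\<dots> < card (supp x)" by (rule card_Diff1_less[OF finite_supp[OF x] i])
    also have "\<dots> = card (supp y)" using card by simp
    finally have less: "card (supp (y \<otimes> inv ?u)) < card (supp y)" .
    have off: "p j (y \<otimes> inv ?u) = p j y" if "j \<in> I" "j \<noteq> i" for j
      using that y uc iI proj_summand[OF iI that(1) uC] by (simp add: proj_mult proj_inv)
    have "i \<notin> supp (y \<otimes> inv ?u) \<and> i \<in> supp y"
    proof (rule ccontr)
      assume "\<not> ?thesis"
      then have "supp y \<subseteq> supp (y \<otimes> inv ?u)" using off by (force simp: supp_def)
      then show False using less card_mono[of "supp (y \<otimes> inv ?u)" "supp y"] y uc by simp
    qed
    moreover from this have "p i y \<otimes> inv ?u = \<one>"
      using iI y uc proj_summand[OF iI iI uC] by (simp add: supp_def proj_mult proj_inv)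
    ultimately show ?thesis using mult_inv_eq_one iI y uc by simp
  qed
  then have "supp x = supp y"
    using card y by (intro card_subset_eq) auto
  show ?thesis
  proof (rule coordinates_eqI[OF y x])
    fix i assume i: "i \<in> I"
    show "p i y = p i x"
    proof (cases "i \<in> supp x")
      case False
      then have "p i x = \<one>" "p i y = \<one>" using i \<open>supp x = supp y\<close> unfolding supp_def by blast+
      then show ?thesis by simp
    qed (use agree in blast)
  qed
qed
end

context rooted_isometry begin

theorem g_id_or_inv: "(\<forall>x\<in>carrier G. g x = x) \<or> (\<forall>x\<in>carrier G. g x = inv x)"
  using g_global_sign
proof
  assume fixed: "\<forall>i\<in>I. \<forall>u\<in>C i. g u = u"
  have "g x = x" if x: "x \<in> carrier G" for x
  proof (rule determined_by_summand_distances[OF x g_carrier[OF x] g_card[OF x]])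
    fix i u assume "i \<in> I" "u \<in> C i"
    then show "card (supp (g x \<otimes> inv u)) = card (supp (x \<otimes> inv u))"
      using g_card_diff[OF x, of u] fixed summand_carrier by simp
  qed
  then show ?thesis by blast
next
  assume flipped: "\<forall>i\<in>I. \<forall>u\<in>C i. g u = inv u"
  have "g x = inv x" if x: "x \<in> carrier G" for x
  proof (rule determined_by_summand_distances)
    show "inv x \<in> carrier G" "g x \<in> carrier G" "card (supp (g x)) = card (supp (inv x))"
      using x g_card by auto
    fix i u assume i: "i \<in> I" and u: "u \<in> C i"
    have uc: "u \<in> carrier G" using i u summand_carrier by blast
    have "g (inv u) = u" using flipped i u uc summand_inv by simp
    then have "card (supp (g x \<otimes> inv u)) = card (supp (x \<otimes> u))"
      using g_card_diff[OF x, of "inv u"] uc by simp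
    also have "x \<otimes> u = inv (inv x \<otimes> inv u)"
      using x uc by (simp add: inv_mult)
    finally show "card (supp (g x \<otimes> inv u)) = card (supp (inv x \<otimes> inv u))"
      using x uc by (simp add: supp_inv)
  qed
  then show ?thesis by blast
qed
end

context countable_direct_sum begin

lemma isometry_after_translation:
  assumes iso: "isometry_of (carrier G) coloured_dist h"
  shows "rooted_isometry G I r C p (\<lambda>x. h x \<otimes> inv (h \<one>))"
proof -
  have h: "bij_betw h (carrier G) (carrier G)" "h \<one> \<in> carrier G"
    using iso by (auto simp: isometry_of_def bij_betw_def)
  have t: "isometry_of (carrier G) coloured_dist (\<lambda>x. x \<otimes> inv (h \<one>))"
    using right_translations_coloured_dist h unfolding right_translations_isometric_def by blast
  have "bij_betw ((\<lambda>x. x \<otimes> inv (h \<one>)) \<circ> h) (carrier G) (carrier G)"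
    using h t bij_betw_trans unfolding isometry_of_def by blast
  moreover have "h x \<in> carrier G" if "x \<in> carrier G" for x
    using that h by (auto simp: bij_betw_def)
  ultimately have "isometry_of (carrier G) coloured_dist (\<lambda>x. h x \<otimes> inv (h \<one>))"
    using iso t by (simp add: isometry_of_def o_def)
  then show ?thesis
    using h by unfold_locales auto
qed

text \<open>Every isometry is a rooted one followed by a translation.\<close>

lemma isometry_translation_or_reflection:
  assumes iso: "isometry_of (carrier G) coloured_dist h"
  shows "(\<forall>x\<in>carrier G. h x = x \<otimes> h \<one>) \<or> (\<forall>x\<in>carrier G. h x = inv x \<otimes> h \<one>)"
proof -
  interpret rooted_isometry G I r C p "\<lambda>x. h x \<otimes> inv (h \<one>)"
    by (rule isometry_after_translation[OF iso])
  have "h x \<in> carrier G" if "x \<in> carrier G" for x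
    using iso that by (auto simp: isometry_of_def bij_betw_def)
  then have "h x = h x \<otimes> inv (h \<one>) \<otimes> h \<one>" if "x \<in> carrier G" for x
    using that by (simp add: m_assoc)
  then show ?thesis using g_id_or_inv by metis
qed

text \<open>
Square roots exclude the isometries \<open>x \<mapsto> x\<^sup>-\<^sup>1 t\<close> as right translations of a group structure: each of
them has a fixed point, and a right translation with a fixed point is the identity.
\<close>

theorem natural_if_square_roots:
  assumes roots: "\<And>x. x \<in> carrier G \<Longrightarrow> \<exists>y\<in>carrier G. y \<otimes> y = x"
  shows "natural_group G"
  unfolding natural_group_def
proof (intro conjI exI[of _ coloured_dist] allI impI)
  show "Group.group G" ..
  show "Metric_space (carrier G) coloured_dist" by (rule Metric_space_coloured_dist)
  show "right_translations_isometric G coloured_dist" by (rule right_translations_coloured_dist)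
  fix H :: "'a monoid"
  assume H: "Group.group H \<and> carrier H = carrier G \<and> right_translations_isometric H coloured_dist"
  then interpret H: Group.group H by simp
  have carr: "carrier H = carrier G" using H by simp
  have iso: "isometry_of (carrier G) coloured_dist (\<lambda>x. x \<otimes>\<^bsub>H\<^esub> a)" if "a \<in> carrier G" for a
    using H that unfolding right_translations_isometric_def by auto
  define \<tau> where "\<tau> a = \<one> \<otimes>\<^bsub>H\<^esub> a" for a
  have H_closed: "a \<otimes>\<^bsub>H\<^esub> b \<in> carrier G" if "a \<in> carrier G" "b \<in> carrier G" for a b
    using H.m_closed that carr by simp
  have translation: "x \<otimes>\<^bsub>H\<^esub> a = x \<otimes> \<tau> a" if a: "a \<in> carrier G" and x: "x \<in> carrier G" for a x
    using isometry_translation_or_reflection[OF iso[OF a]]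
  proof
    assume "\<forall>x\<in>carrier G. x \<otimes>\<^bsub>H\<^esub> a = x \<otimes> (\<one> \<otimes>\<^bsub>H\<^esub> a)"
    then show ?thesis using x unfolding \<tau>_def by blast
  next
    assume refl: "\<forall>x\<in>carrier G. x \<otimes>\<^bsub>H\<^esub> a = inv x \<otimes> (\<one> \<otimes>\<^bsub>H\<^esub> a)"
    obtain z where z: "z \<in> carrier G" "z \<otimes> z = \<tau> a"
      using roots[of "\<tau> a"] H_closed[OF _ a] by (auto simp: \<tau>_def)
    have "z \<otimes>\<^bsub>H\<^esub> a = inv z \<otimes> (z \<otimes> z)"
      using bspec[OF refl z(1)] z(2) unfolding \<tau>_def by simp
    also have "\<dots> = z" using z(1) by (simp add: m_assoc[symmetric])
    finally have "a = \<one>\<^bsub>H\<^esub>" using H.l_cancel_one[of z a] z a carr by simp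
    then show ?thesis using x carr H.r_one by (simp add: \<tau>_def)
  qed
  have "\<tau> \<in> iso H G"
  proof (rule isoI)
    show "\<tau> \<in> hom H G"
    proof (rule homI)
      show "\<tau> a \<in> carrier G" if "a \<in> carrier H" for a
        using that carr H_closed by (simp add: \<tau>_def)
      show "\<tau> (a \<otimes>\<^bsub>H\<^esub> b) = \<tau> a \<otimes> \<tau> b" if ab: "a \<in> carrier H" "b \<in> carrier H" for a b
      proof -
        have "\<tau> (a \<otimes>\<^bsub>H\<^esub> b) = \<tau> a \<otimes>\<^bsub>H\<^esub> b"
          using ab carr H.m_assoc[of \<one> a b] by (simp add: \<tau>_def)
        also have "\<dots> = \<tau> a \<otimes> \<tau> b" using ab carr by (intro translation) (auto simp: \<tau>_def H_closed)
        finally show ?thesis .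
      qed
    qed
    show "bij_betw \<tau> (carrier H) (carrier G)"
      unfolding \<tau>_def
    proof (rule bij_betw_byWitness[of _ "\<lambda>b. inv\<^bsub>H\<^esub> \<one> \<otimes>\<^bsub>H\<^esub> b"])
      have 1: "\<one> \<in> carrier H" using carr by simp
      show "\<forall>a\<in>carrier H. inv\<^bsub>H\<^esub> \<one> \<otimes>\<^bsub>H\<^esub> (\<one> \<otimes>\<^bsub>H\<^esub> a) = a"
        using 1 by (simp add: H.m_assoc[symmetric])
      show "\<forall>a\<in>carrier G. \<one> \<otimes>\<^bsub>H\<^esub> (inv\<^bsub>H\<^esub> \<one> \<otimes>\<^bsub>H\<^esub> a) = a"
        using 1 by (simp add: H.m_assoc[symmetric] carr[symmetric])
      show "(\<lambda>a. \<one> \<otimes>\<^bsub>H\<^esub> a) ` carrier H \<subseteq> carrier G"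
        using 1 carr H_closed by auto
      show "(\<lambda>b. inv\<^bsub>H\<^esub> \<one> \<otimes>\<^bsub>H\<^esub> b) ` carrier G \<subseteq> carrier H"
        using 1 H.m_closed H.inv_closed carr by auto
    qed
  qed
  then show "H \<cong> G" by (auto simp: is_iso_def)
qed
end

section \<open>Divisible abelian groups\<close>

context group begin

definition divisible :: "'a set \<Rightarrow> bool" where
  "divisible K \<longleftrightarrow> (\<forall>x\<in>K. \<forall>n::nat. n > 0 \<longrightarrow> (\<exists>y\<in>K. y [^] n = x))"

lemma divisibleE:
  assumes "divisible K" "x \<in> K" "n > 0"
  obtains y where "y \<in> K" "y [^] (n::nat) = x"
  using assms unfolding divisible_def by blast

lemma subgroup_Union_chain:
  assumes ne: "\<K> \<noteq> {}" and sub: "\<And>K. K \<in> \<K> \<Longrightarrow> subgroup K G"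
    and chain: "\<And>K L. K \<in> \<K> \<Longrightarrow> L \<in> \<K> \<Longrightarrow> K \<subseteq> L \<or> L \<subseteq> K"
  shows "subgroup (\<Union>\<K>) G"
proof (rule subgroupI)
  show "\<Union>\<K> \<subseteq> carrier G" using sub subgroup.subset by blast
  show "\<Union>\<K> \<noteq> {}" using ne sub subgroup.one_closed by blast
  show "inv a \<in> \<Union>\<K>" if "a \<in> \<Union>\<K>" for a
  proof -
    obtain K where K: "K \<in> \<K>" "a \<in> K" using \<open>a \<in> \<Union>\<K>\<close> by blast
    show ?thesis using subgroup.m_inv_closed[OF sub[OF K(1)] K(2)] K(1) by blast
  qed
  show "a \<otimes> b \<in> \<Union>\<K>" if "a \<in> \<Union>\<K>" "b \<in> \<Union>\<K>" for a b
  proof -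
    obtain K L where KL: "K \<in> \<K>" "L \<in> \<K>" "a \<in> K" "b \<in> L" using \<open>a \<in> \<Union>\<K>\<close> \<open>b \<in> \<Union>\<K>\<close> by blast
    then obtain M where M: "M \<in> \<K>" "a \<in> M" "b \<in> M" using chain[of K L] by blast
    show ?thesis using subgroup.m_closed[OF sub[OF M(1)] M(2,3)] M(1) by blast
  qed
qed

text \<open>
In a finite group the power with exponent the group order is trivial, so that divisibility leaves
only the identity.
\<close>

lemma divisible_infinite:
  assumes K: "subgroup K G" and div: "divisible K" and nt: "K \<noteq> {\<one>}"
  shows "infinite K"
proof
  assume fin: "finite K"
  interpret K: group "G\<lparr>carrier := K\<rparr>" by (rule subgroup_imp_group[OF K])
  have pos: "card K > 0" using fin subgroup.one_closed[OF K] by (auto simp: card_gt_0_iff)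
  have "x = \<one>" if x: "x \<in> K" for x
  proof -
    obtain y where y: "y \<in> K" "y [^] card K = x" using divisibleE[OF div x pos] by blast
    then show ?thesis using K.pow_order_eq_1[of y] nat_pow_consistent[of y "card K" K]
      by (simp add: order_def)
  qed
  then show False using nt subgroup.one_closed[OF K] by blast
qed

text \<open>
Gives finiteness of the supports in the direct sum, and lets independence pass to unions of chains.
\<close>

lemma generate_finite_support:
  assumes "x \<in> generate G (\<Union>\<F>)"
  shows "\<exists>S. finite S \<and> S \<subseteq> \<F> \<and> x \<in> generate G (\<Union>S)"
  using assms
proof (induction rule: generate.induct)
  case one
  show ?case by (rule exI[of _ "{}"]) (auto intro: generate.one)
next
  case (incl h)
  then obtain C where "C \<in> \<F>" "h \<in> C" by blast
  then show ?case by (intro exI[of _ "{C}"]) (auto intro: generate.incl)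
next
  case (inv h)
  then obtain C where "C \<in> \<F>" "h \<in> C" by blast
  then show ?case by (intro exI[of _ "{C}"]) (auto intro: generate.inv)
next
  case (eng h1 h2)
  then obtain S1 S2 where S: "finite S1" "S1 \<subseteq> \<F>" "h1 \<in> generate G (\<Union>S1)"
    "finite S2" "S2 \<subseteq> \<F>" "h2 \<in> generate G (\<Union>S2)" by blast
  have "h1 \<in> generate G (\<Union>(S1 \<union> S2))" "h2 \<in> generate G (\<Union>(S1 \<union> S2))"
    using S mono_generate[of "\<Union>S1" "\<Union>(S1 \<union> S2)"] mono_generate[of "\<Union>S2" "\<Union>(S1 \<union> S2)"] by auto
  then show ?case using S by (intro exI[of _ "S1 \<union> S2"]) (auto intro: generate.eng)
qed

end

context comm_group begin

lemma divisible_generate: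
  assumes sub: "A \<subseteq> carrier G" and roots: "\<And>x n. x \<in> A \<Longrightarrow> n > 0 \<Longrightarrow> \<exists>y\<in>A. y [^] (n::nat) = x"
  shows "divisible (generate G A)"
  unfolding divisible_def
proof (intro ballI allI impI)
  fix x and n :: nat assume x: "x \<in> generate G A" and n: "n > 0"
  show "\<exists>y\<in>generate G A. y [^] n = x"
    using x
  proof (induction rule: generate.induct)
    case one
    show ?case by (rule bexI[of _ \<one>]) (auto intro: generate.one)
  next
    case (incl h)
    then show ?case using roots[OF incl n] generate.incl by metis
  next
    case (inv h)
    then obtain y where y: "y \<in> A" "y [^] n = h" using roots n by blast
    then have "(inv y) [^] n = inv h" using sub nat_pow_inv by blast
    then show ?case using y generate.inv by metis
  next
    case (eng h1 h2)
    then obtain y1 y2 where y: "y1 \<in> generate G A" "y1 [^] n = h1" "y2 \<in> generate G A" "y2 [^] n = h2"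
      by blast
    then have "(y1 \<otimes> y2) [^] n = h1 \<otimes> h2"
      using generate_in_carrier[OF sub] nat_pow_distrib by blast
    then show ?case using y generate.eng by metis
  qed
qed

lemma generate_insert_subgroup:
  assumes C: "subgroup C G" and sub: "\<Union>\<F> \<subseteq> carrier G"
  shows "generate G (\<Union>(insert C \<F>)) = C <#> generate G (\<Union>\<F>)"
proof
  have gen: "subgroup (generate G (\<Union>\<F>)) G" by (rule generate_is_subgroup[OF sub])
  have "C \<subseteq> C <#> generate G (\<Union>\<F>)"
    unfolding set_mult_def using subgroup.mem_carrier[OF C] generate.one[of G "\<Union>\<F>"] by force
  moreover have "\<Union>\<F> \<subseteq> C <#> generate G (\<Union>\<F>)"
    unfolding set_mult_def using subgroup.one_closed[OF C] sub generate.incl[of _ "\<Union>\<F>" G] by force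
  ultimately show "generate G (\<Union>(insert C \<F>)) \<subseteq> C <#> generate G (\<Union>\<F>)"
    by (intro generate_subgroup_incl mult_subgroups[OF C gen]) auto
  show "C <#> generate G (\<Union>\<F>) \<subseteq> generate G (\<Union>(insert C \<F>))"
  proof
    fix x assume "x \<in> C <#> generate G (\<Union>\<F>)"
    then obtain c d where "c \<in> C" "d \<in> generate G (\<Union>\<F>)" "x = c \<otimes> d"
      unfolding set_mult_def by blast
    then show "x \<in> generate G (\<Union>(insert C \<F>))"
      using mono_generate[of "\<Union>\<F>" "\<Union>(insert C \<F>)"] by (auto intro: generate.eng generate.incl)
  qed
qed

text \<open>
A maximal subgroup \<open>K\<close> with trivial intersection with \<open>D\<close> is a complement. For \<open>x\<close> outside \<open>D K\<close>, let
\<open>m\<close> be the least positive exponent with \<open>x\<^sup>m \<in> D K\<close>, if there is one. Dividing \<open>x\<close> by an \<open>m\<close>-th root of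
the \<open>D\<close>-part of \<open>x\<^sup>m\<close>, which exists since \<open>D\<close> is divisible, gives \<open>y\<close> with \<open>y\<^sup>m \<in> K\<close>, and then all powers
of \<open>y\<close> that lie in \<open>D K\<close> already lie in \<open>K\<close>. Adjoining \<open>y\<close> to \<open>K\<close> contradicts maximality.
\<close>

lemma divisible_complement:
  assumes D: "subgroup D G" and div: "divisible D"
  obtains K where "subgroup K G" "K \<inter> D = {\<one>}" "D <#> K = carrier G"
proof -
  let ?A = "{K. subgroup K G \<and> K \<inter> D = {\<one>}}"
  have "\<exists>M\<in>?A. \<forall>X\<in>?A. M \<subseteq> X \<longrightarrow> X = M"
  proof (rule subset_Zorn_nonempty)
    have "{\<one>} \<in> ?A" using triv_subgroup subgroup.one_closed[OF D] by auto
    then show "?A \<noteq> {}" by blast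
    fix \<C> assume ne: "\<C> \<noteq> {}" and ch: "subset.chain ?A \<C>"
    then have sub: "K \<in> ?A" if "K \<in> \<C>" for K
      using that by (auto simp: subset.chain_def)
    have "subgroup (\<Union>\<C>) G"
    proof (rule subgroup_Union_chain[OF ne])
      show "subgroup K G" if "K \<in> \<C>" for K using sub[OF that] by blast
      show "K \<subseteq> L \<or> L \<subseteq> K" if "K \<in> \<C>" "L \<in> \<C>" for K L
        using ch that unfolding subset_chain_def by blast
    qed
    moreover have "\<Union>\<C> \<inter> D = {\<one>}" using sub ne by blast
    ultimately show "\<Union>\<C> \<in> ?A" by blast
  qed
  then obtain K where "K \<in> ?A" and maximal: "\<forall>X\<in>?A. K \<subseteq> X \<longrightarrow> X = K" by (rule bexE)
  then have K: "subgroup K G" "K \<inter> D = {\<one>}" by simp_all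
  have max: "X = K" if "subgroup X G" "X \<inter> D = {\<one>}" "K \<subseteq> X" for X
    using bspec[OF maximal, of X] that by simp
  let ?S = "D <#> K"
  have S: "subgroup ?S G" by (rule mult_subgroups[OF D K(1)])
  have DS: "D \<subseteq> ?S" unfolding set_mult_def
    using subgroup.one_closed[OF K(1)] subgroup.mem_carrier[OF D] by force
  have KS: "K \<subseteq> ?S" unfolding set_mult_def
    using subgroup.one_closed[OF D] subgroup.mem_carrier[OF K(1)] by force
  have no_extension: False
    if y: "y \<in> carrier G" "y \<notin> ?S" and powers: "\<And>e::int. y [^] e \<in> ?S \<Longrightarrow> y [^] e \<in> K" for y
  proof -
    let ?Y = "generate G {y}"
    let ?X = "K <#> ?Y"
    have Y: "subgroup ?Y G" using y by (intro generate_is_subgroup) simp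
    have X: "subgroup ?X G" by (rule mult_subgroups[OF K(1) Y])
    have KX: "K \<subseteq> ?X" unfolding set_mult_def
      using subgroup.one_closed[OF Y] subgroup.mem_carrier[OF K(1)] by force
    have "y \<in> ?X" unfolding set_mult_def
      using subgroup.one_closed[OF K(1)] generate.incl[of y "{y}" G] y by force
    then have "?X \<noteq> K" using y KS by blast
    then have "?X \<inter> D \<noteq> {\<one>}" using max[OF X _ KX] by blast
    then obtain d where d: "d \<in> ?X" "d \<in> D" "d \<noteq> \<one>"
      using subgroup.one_closed[OF X] subgroup.one_closed[OF D] by blast
    then obtain k e where k: "k \<in> K" and de: "d = k \<otimes> y [^] (e::int)"
      unfolding set_mult_def generate_pow[OF y(1)] by blast
    have kc: "k \<in> carrier G" using k subgroup.mem_carrier[OF K(1)] by blast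
    have "y [^] e = inv k \<otimes> d" using de kc y by (simp add: m_assoc[symmetric])
    moreover have "inv k \<otimes> d \<in> ?S"
      using k d DS KS S by (meson subgroup.m_closed subgroup.m_inv_closed subsetD)
    ultimately have "y [^] e \<in> ?S" by simp
    then have "y [^] e \<in> K" by (rule powers)
    then have "d \<in> K" using de k subgroup.m_closed[OF K(1)] by blast
    then show False using d K by blast
  qed
  have "x \<in> ?S" if x: "x \<in> carrier G" for x
  proof (rule ccontr)
    assume nx: "x \<notin> ?S"
    show False
    proof (cases "\<exists>e::int. e \<noteq> 0 \<and> x [^] e \<in> ?S")
      case False
      have "x [^] e \<in> K" if "x [^] e \<in> ?S" for e :: int
        using False that subgroup.one_closed[OF K(1)] by (cases "e = 0") auto
      then show False using no_extension[OF x nx] by blast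
    next
      case True
      then obtain e :: int where e: "e \<noteq> 0" "x [^] e \<in> ?S" by blast
      have "x [^] (- e) \<in> ?S"
        using subgroup.m_inv_closed[OF S e(2)] x by (simp add: int_pow_neg)
      then have ex: "\<exists>m>0. x [^] int m \<in> ?S"
        using e by (intro exI[of _ "nat \<bar>e\<bar>"]) (auto simp: abs_if)
      \<comment> \<open>Only the powers with exponent divisible by \<open>m\<close> lie in \<open>D K\<close>.\<close>
      define m where "m = (LEAST m. m > 0 \<and> x [^] int m \<in> ?S)"
      have m: "m > 0" "x [^] int m \<in> ?S" using LeastI_ex[OF ex] by (auto simp: m_def)
      have least: "m \<le> l" if "l > 0" "x [^] int l \<in> ?S" for l
        unfolding m_def using that by (intro Least_le) auto
      obtain d k where dk: "d \<in> D" "k \<in> K" "x [^] int m = d \<otimes> k"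
        using m(2) unfolding set_mult_def by blast
      obtain c where c: "c \<in> D" "c [^] m = d" using divisibleE[OF div dk(1) m(1)] by blast
      have carr: "c \<in> carrier G" "d \<in> carrier G" "k \<in> carrier G"
        using c dk subgroup.mem_carrier[OF D] subgroup.mem_carrier[OF K(1)] by auto
      define y where "y = x \<otimes> inv c"
      have y: "y \<in> carrier G" using x carr by (simp add: y_def)
      have cS: "c [^] e \<in> ?S" for e :: int
        using subgroup_int_pow_closed[OF D c(1)] DS by blast
      have ye: "x [^] e = y [^] e \<otimes> c [^] e" for e :: int
        using x carr by (simp add: y_def int_pow_distrib int_pow_inv m_assoc)
      have xS: "x [^] e \<in> ?S" if "y [^] e \<in> ?S" for e :: int
        using that cS ye subgroup.m_closed[OF S] by simp
      have yS: "y \<notin> ?S" using xS[of 1] nx x y by auto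
      have "y [^] int m = x [^] int m \<otimes> inv (c [^] int m)"
        using x carr by (simp add: y_def int_pow_distrib int_pow_inv)
      also have "\<dots> = k"
        unfolding int_pow_int[of G c] c(2) dk(3) using carr by (simp add: m_comm[of d k] m_assoc)
      finally have ym: "y [^] int m = k" .
      have "y [^] e \<in> K" if eS: "y [^] e \<in> ?S" for e :: int
      proof -
        have "x [^] (e mod int m) = x [^] e \<otimes> inv ((x [^] int m) [^] (e div int m))"
          using x by (simp add: int_pow_pow int_pow_diff[symmetric] minus_mult_div_eq_mod)
        also have "\<dots> \<in> ?S"
          using xS[OF eS] subgroup_int_pow_closed[OF S m(2)] S
          by (intro subgroup.m_closed[OF S] subgroup.m_inv_closed[OF S])
        finally have "x [^] int (nat (e mod int m)) \<in> ?S" using m(1) by simp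
        then have "\<not> nat (e mod int m) > 0"
          using least[of "nat (e mod int m)"] m(1) pos_mod_bound[of "int m" e] by linarith
        then have "e = int m * (e div int m)"
          using m(1) pos_mod_sign[of "int m" e] mult_div_mod_eq[of "int m" e] by linarith
        then have "y [^] e = (y [^] int m) [^] (e div int m)"
          using y by (simp add: int_pow_pow)
        then show ?thesis using ym subgroup_int_pow_closed[OF K(1) dk(2)] by simp
      qed
      then show False using no_extension[OF y yS] by blast
    qed
  qed
  then have "?S = carrier G" using subgroup.subset[OF S] by blast
  then show thesis using that K by blast
qed

text \<open>A direct factor of a divisible group is divisible: take the component of a root.\<close>

lemma complement_divisible:
  assumes D: "subgroup D G" and K: "subgroup K G" "K \<inter> D = {\<one>}" "D <#> K = carrier G"
    and div: "divisible (carrier G)"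
  shows "divisible K"
  unfolding divisible_def
proof (intro ballI allI impI)
  fix x and n :: nat assume x: "x \<in> K" and n: "n > 0"
  have xc: "x \<in> carrier G" using x subgroup.mem_carrier[OF K(1)] by blast
  obtain y where y: "y \<in> carrier G" "y [^] n = x" using divisibleE[OF div xc n] by blast
  then obtain d k where dk: "d \<in> D" "k \<in> K" "y = d \<otimes> k"
    using K(3) unfolding set_mult_def by blast
  have c: "d \<in> carrier G" "k \<in> carrier G"
    using dk subgroup.mem_carrier[OF D] subgroup.mem_carrier[OF K(1)] by auto
  have kn: "k [^] n \<in> K" and dn: "d [^] n \<in> D"
    using subgroup_int_pow_closed[OF K(1) dk(2), of "int n"]
      subgroup_int_pow_closed[OF D dk(1), of "int n"] by (simp_all add: int_pow_int)
  have xe: "x = d [^] n \<otimes> k [^] n" using y dk c by (simp add: nat_pow_distrib)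
  then have "d [^] n = x \<otimes> inv (k [^] n)" using c by (simp add: m_assoc)
  also have "\<dots> \<in> K" using x kn by (intro subgroup.m_closed[OF K(1)] subgroup.m_inv_closed[OF K(1)])
  finally have "d [^] n = \<one>" using dn K(2) by blast
  then show "\<exists>y\<in>K. y [^] n = x" using xe dk c by auto
qed

text \<open>
Start with \<open>y\<^sub>0 \<noteq> 1\<close> and choose \<open>y\<^sub>n\<^sub>+\<^sub>1\<close> as an \<open>(n+1)\<close>-th root of \<open>y\<^sub>n\<close>. The powers of the \<open>y\<^sub>n\<close> form the
union of an increasing sequence of cyclic groups. It contains \<open>k\<close>-th roots, because \<open>k\<close> divides \<open>n+1\<close>
for arbitrarily large \<open>n\<close>.
\<close>

lemma countable_divisible_subgroup:
  assumes K: "subgroup K G" and div: "divisible K" and nt: "K \<noteq> {\<one>}"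
  obtains C where "subgroup C G" "C \<subseteq> K" "countable C" "divisible C" "C \<noteq> {\<one>}"
proof -
  obtain a where a: "a \<in> K" "a \<noteq> \<one>" using nt subgroup.one_closed[OF K] by blast
  define root where "root n x = (SOME y. y \<in> K \<and> y [^] Suc n = x)" for n x
  have root: "root n x \<in> K" "root n x [^] Suc n = x" if "x \<in> K" for n x
  proof -
    have "\<exists>y. y \<in> K \<and> y [^] Suc n = x" using divisibleE[OF div that, of "Suc n"] by blast
    then show "root n x \<in> K" "root n x [^] Suc n = x"
      unfolding root_def by (metis (mono_tags, lifting) someI_ex)+
  qed
  define y where "y = rec_nat a root"
  have y_simps: "y 0 = a" "y (Suc n) = root n (y n)" for n by (simp_all add: y_def)
  have yK: "y n \<in> K" for n by (induction n) (use a root y_simps in simp_all)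
  have yc [simp]: "y n \<in> carrier G" for n using yK subgroup.mem_carrier[OF K] by blast
  have y_Suc: "y (Suc n) [^] Suc n = y n" for n
    unfolding y_simps by (rule root(2)[OF yK])
  have y_add: "\<exists>q::int. y n = y (n + j) [^] q" for n j
  proof (induction j)
    case 0
    show ?case by (rule exI[of _ 1]) simp
  next
    case (Suc j)
    then obtain q :: int where "y n = y (n + j) [^] q" by blast
    also have "y (n + j) = y (n + Suc j) [^] int (Suc (n + j))"
      using y_Suc[of "n + j"] unfolding int_pow_int by simp
    finally have "y n = y (n + Suc j) [^] (int (Suc (n + j)) * q)"
      by (simp only: int_pow_pow yc)
    then show ?case by blast
  qed
  have y_le: "\<exists>q::int. y n = y N [^] q" if "n \<le> N" for n N
    using y_add[of n "N - n"] that by simp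
  define C where "C = range (\<lambda>(n, e::int). y n [^] e)"
  have C_I: "y n [^] e \<in> C" for n and e :: int unfolding C_def by (metis case_prod_conv rangeI)
  have C_E: "\<exists>n (e::int). x = y n [^] e" if "x \<in> C" for x using that unfolding C_def by auto
  have "subgroup C G"
  proof (rule subgroupI)
    show "C \<subseteq> carrier G" using C_E by fastforce
    show "C \<noteq> {}" using C_I by blast
    show "inv x \<in> C" if "x \<in> C" for x
      using C_E[OF that] C_I int_pow_neg[OF yc] by metis
    show "x \<otimes> z \<in> C" if "x \<in> C" "z \<in> C" for x z
    proof -
      obtain n m and e f :: int where x: "x = y n [^] e" and z: "z = y m [^] f"
        using C_E \<open>x \<in> C\<close> \<open>z \<in> C\<close> by meson
      obtain q r :: int where "y n = y (max n m) [^] q" "y m = y (max n m) [^] r"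
        using y_le[of n "max n m"] y_le[of m "max n m"] by auto
      then have "x \<otimes> z = y (max n m) [^] (q * e + r * f)"
        unfolding x z by (simp add: int_pow_mult int_pow_pow)
      then show ?thesis using C_I by simp
    qed
  qed
  moreover have "C \<subseteq> K" using C_E subgroup_int_pow_closed[OF K yK] by fastforce
  moreover have "countable C" unfolding C_def by simp
  moreover have "divisible C"
    unfolding divisible_def
  proof (intro ballI allI impI)
    fix x and k :: nat assume x: "x \<in> C" and k: "k > 0"
    obtain n and e :: int where x: "x = y n [^] e" using C_E[OF x] by blast
    \<comment> \<open>An index not below \<open>n\<close> at which the next root taken is a \<open>(k (n+1))\<close>-th one.\<close>
    define N where "N = k * Suc n - 1"
    have N: "Suc N = k * Suc n" using k by (simp add: N_def)
    have "Suc n \<le> Suc N" unfolding N using k mult_le_mono1[of 1 k "Suc n"] by simp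
    then obtain q :: int where q: "y n = y N [^] q" using y_le[of n N] by auto
    have "y N = y (Suc N) [^] int (k * Suc n)"
      using y_Suc[of N] unfolding N[symmetric] int_pow_int by simp
    then have "x = y (Suc N) [^] (int (k * Suc n) * q * e)"
      unfolding x q by (simp only: int_pow_pow yc)
    also have "int (k * Suc n) * q * e = (int (Suc n) * q * e) * int k" by (simp add: algebra_simps)
    also have "y (Suc N) [^] \<dots> = (y (Suc N) [^] (int (Suc n) * q * e)) [^] k"
      by (simp only: int_pow_pow[symmetric] yc int_pow_int)
    finally show "\<exists>z\<in>C. z [^] k = x" using C_I by metis
  qed
  moreover have "C \<noteq> {\<one>}" using C_I[of 0 1] a y_simps by auto
  ultimately show thesis using that by blast
qed

end

context comm_group begin

definition independent_family :: "'a set set \<Rightarrow> bool" where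
  "independent_family \<F> \<longleftrightarrow> (\<forall>C\<in>\<F>. C \<inter> generate G (\<Union>(\<F> - {C})) = {\<one>})"

definition direct_divisible_family :: "'a set set \<Rightarrow> bool" where
  "direct_divisible_family \<F> \<longleftrightarrow> independent_family \<F> \<and>
     (\<forall>C\<in>\<F>. subgroup C G \<and> countable C \<and> divisible C \<and> C \<noteq> {\<one>})"

lemma direct_divisible_family_Union_chain:
  assumes ne: "\<C> \<noteq> {}" and chain: "subset.chain {\<F>. direct_divisible_family \<F>} \<C>"
  shows "direct_divisible_family (\<Union>\<C>)"
proof -
  have lines: "direct_divisible_family \<F>" if "\<F> \<in> \<C>" for \<F>
    using that chain unfolding subset_chain_def by blast
  have good: "subgroup C G" "countable C" "divisible C" "C \<noteq> {\<one>}" if "C \<in> \<Union>\<C>" for C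
    using that lines unfolding direct_divisible_family_def by blast+
  have "independent_family (\<Union>\<C>)"
    unfolding independent_family_def
  proof
    fix C assume C: "C \<in> \<Union>\<C>"
    have "x = \<one>" if x: "x \<in> C" "x \<in> generate G (\<Union>(\<Union>\<C> - {C}))" for x
    proof -
      obtain S where S: "finite S" "S \<subseteq> \<Union>\<C> - {C}" "x \<in> generate G (\<Union>S)"
        using generate_finite_support[OF x(2)] by blast
      obtain \<F> where \<F>: "\<F> \<in> \<C>" "insert C S \<subseteq> \<F>"
        by (rule finite_subset_Union_chain[OF _ _ ne chain, of "insert C S"]) (use S C in auto)
      have "x \<in> generate G (\<Union>(\<F> - {C}))"
        using S \<F> mono_generate[of "\<Union>S" "\<Union>(\<F> - {C})"] by blast
      moreover have "C \<inter> generate G (\<Union>(\<F> - {C})) = {\<one>}"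
        using lines[OF \<F>(1)] \<F>(2) unfolding direct_divisible_family_def independent_family_def by blast
      ultimately show ?thesis using x by blast
    qed
    moreover have "\<one> \<in> C" by (rule subgroup.one_closed[OF good(1)[OF C]])
    ultimately show "C \<inter> generate G (\<Union>(\<Union>\<C> - {C})) = {\<one>}"
      using generate.one[of G "\<Union>(\<Union>\<C> - {C})"] by blast
  qed
  then show ?thesis unfolding direct_divisible_family_def using good by blast
qed

text \<open>
For an old member \<open>B\<close>, an element \<open>x = c d\<close> of \<open>B\<close>, with \<open>c \<in> C\<close> and \<open>d\<close> in the span of the other old
members, has \<open>c\<close> in the span of all old members. So \<open>c\<close> is trivial and the independence of the old
family applies.
\<close>

lemma direct_divisible_family_insert:
  assumes lines: "direct_divisible_family \<F>" and C: "subgroup C G" "countable C" "divisible C" "C \<noteq> {\<one>}"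
    and meet: "C \<inter> generate G (\<Union>\<F>) = {\<one>}"
  shows "direct_divisible_family (insert C \<F>)"
proof -
  have sub: "subgroup B G" if "B \<in> \<F>" for B
    using lines that unfolding direct_divisible_family_def by blast
  have carr: "\<Union>\<G> \<subseteq> carrier G" if "\<G> \<subseteq> \<F>" for \<G>
    using that subgroup.subset[OF sub] by blast
  have "C \<notin> \<F>"
  proof
    assume "C \<in> \<F>"
    then have "C \<subseteq> generate G (\<Union>\<F>)" by (blast intro: generate.incl)
    then show False using meet C(4) by blast
  qed
  have "B \<inter> generate G (\<Union>(insert C \<F> - {B})) = {\<one>}" if B: "B \<in> \<F>" for B
  proof -
    have "x = \<one>" if x: "x \<in> B" "x \<in> generate G (\<Union>(insert C \<F> - {B}))" for x
    proof -
      have "insert C \<F> - {B} = insert C (\<F> - {B})" using B \<open>C \<notin> \<F>\<close> by blast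
      then have "x \<in> C <#> generate G (\<Union>(\<F> - {B}))"
        using x(2) generate_insert_subgroup[OF C(1), of "\<F> - {B}"] carr[of "\<F> - {B}"] by auto
      then obtain c d where cd: "c \<in> C" "d \<in> generate G (\<Union>(\<F> - {B}))" "x = c \<otimes> d"
        unfolding set_mult_def by blast
      have D: "subgroup (generate G (\<Union>\<F>)) G" by (rule generate_is_subgroup) (rule carr, simp)
      have dD: "d \<in> generate G (\<Union>\<F>)" using cd mono_generate[of "\<Union>(\<F> - {B})" "\<Union>\<F>"] by blast
      have xD: "x \<in> generate G (\<Union>\<F>)" using x B by (blast intro: generate.incl)
      have carrs: "c \<in> carrier G" "d \<in> carrier G"
        using cd(1) dD subgroup.mem_carrier[OF C(1)] subgroup.mem_carrier[OF D] by auto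
      then have "c = x \<otimes> inv d" using cd(3) by (simp add: m_assoc)
      then have "c \<in> generate G (\<Union>\<F>)"
        using xD dD subgroup.m_closed[OF D] subgroup.m_inv_closed[OF D] by simp
      then have "c = \<one>" using cd(1) meet by blast
      then have "x \<in> generate G (\<Union>(\<F> - {B}))" using cd carrs by simp
      moreover have "B \<inter> generate G (\<Union>(\<F> - {B})) = {\<one>}"
        using lines B unfolding direct_divisible_family_def independent_family_def by blast
      ultimately show ?thesis using x by blast
    qed
    moreover have "\<one> \<in> B" by (rule subgroup.one_closed[OF sub[OF B]])
    ultimately show ?thesis using generate.one[of G "\<Union>(insert C \<F> - {B})"] by blast
  qed
  moreover have "insert C \<F> - {C} = \<F>" using \<open>C \<notin> \<F>\<close> by blast
  ultimately have "independent_family (insert C \<F>)"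
    using meet unfolding independent_family_def by simp
  then show ?thesis using lines C unfolding direct_divisible_family_def by simp
qed

text \<open>
The span of a maximal family is divisible, hence has a complement. If the complement were
non-trivial, then a countable divisible subgroup of it would enlarge the family.
\<close>

lemma direct_divisible_family_span:
  assumes div: "divisible (carrier G)"
  obtains \<F> where "direct_divisible_family \<F>" "generate G (\<Union>\<F>) = carrier G"
proof -
  have "\<exists>\<F>\<in>{\<F>. direct_divisible_family \<F>}. \<forall>X\<in>{\<F>. direct_divisible_family \<F>}. \<F> \<subseteq> X \<longrightarrow> X = \<F>"
  proof (rule subset_Zorn_nonempty)
    have "direct_divisible_family {}" by (simp add: direct_divisible_family_def independent_family_def)
    then show "{\<F>. direct_divisible_family \<F>} \<noteq> {}" by blast
  qed (use direct_divisible_family_Union_chain in blast)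
  then obtain \<F> where \<F>: "direct_divisible_family \<F>"
    and max: "\<And>X. direct_divisible_family X \<Longrightarrow> \<F> \<subseteq> X \<Longrightarrow> X = \<F>" by blast
  have good: "subgroup C G" "divisible C" if "C \<in> \<F>" for C
    using \<F> that unfolding direct_divisible_family_def by blast+
  have carr: "\<Union>\<F> \<subseteq> carrier G" using subgroup.subset[OF good(1)] by blast
  let ?D = "generate G (\<Union>\<F>)"
  have D: "subgroup ?D G" by (rule generate_is_subgroup[OF carr])
  have divD: "divisible ?D"
  proof (rule divisible_generate[OF carr])
    fix x and n :: nat assume "x \<in> \<Union>\<F>" "n > 0"
    then obtain C where C: "C \<in> \<F>" "x \<in> C" by blast
    show "\<exists>y\<in>\<Union>\<F>. y [^] n = x"
      using divisibleE[OF good(2)[OF C(1)] C(2) \<open>n > 0\<close>] C(1) by blast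
  qed
  obtain K where K: "subgroup K G" "K \<inter> ?D = {\<one>}" "?D <#> K = carrier G"
    using divisible_complement[OF D divD] by blast
  have divK: "divisible K" by (rule complement_divisible[OF D K div])
  have "K = {\<one>}"
  proof (rule ccontr)
    assume "K \<noteq> {\<one>}"
    then obtain C where C: "subgroup C G" "C \<subseteq> K" "countable C" "divisible C" "C \<noteq> {\<one>}"
      using countable_divisible_subgroup[OF K(1) divK] by blast
    have meet: "C \<inter> ?D = {\<one>}" using C K subgroup.one_closed[OF C(1)] by blast
    have "insert C \<F> = \<F>"
      using max[OF direct_divisible_family_insert[OF \<F> C(1,3,4,5) meet]] by blast
    then have "C \<subseteq> ?D" by (blast intro: generate.incl)
    then show False using meet C(5) by blast
  qed
  then have "x \<in> ?D" if x: "x \<in> carrier G" for x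
  proof -
    have "x \<in> ?D <#> K" using K(3) x by simp
    then obtain d where "d \<in> ?D" "x = d \<otimes> \<one>"
      unfolding set_mult_def \<open>K = {\<one>}\<close> by blast
    then show ?thesis using subgroup.mem_carrier[OF D] by simp
  qed
  then have "?D = carrier G" using subgroup.subset[OF D] by blast
  then show thesis using that \<F> by blast
qed

lemma projection_along_complement:
  assumes C: "subgroup C G" and R: "subgroup R G"
    and meet: "C \<inter> R = {\<one>}" and span: "C <#> R = carrier G"
  obtains \<pi> where "\<pi> \<in> hom G G" "\<And>x. x \<in> carrier G \<Longrightarrow> \<pi> x \<in> C"
    "\<And>c \<rho>. c \<in> C \<Longrightarrow> \<rho> \<in> R \<Longrightarrow> \<pi> (c \<otimes> \<rho>) = c"
proof -
  note Cc = subgroup.mem_carrier[OF C] and Rc = subgroup.mem_carrier[OF R]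
  have unique: "c = c'" if "c \<in> C" "c' \<in> C" "\<rho> \<in> R" "\<rho>' \<in> R" "c \<otimes> \<rho> = c' \<otimes> \<rho>'" for c c' \<rho> \<rho>'
  proof -
    have m: "c \<in> carrier G" "c' \<in> carrier G" "\<rho> \<in> carrier G" "\<rho>' \<in> carrier G"
      using that Cc Rc by auto
    have "inv c' \<otimes> c = inv c' \<otimes> (c \<otimes> \<rho>) \<otimes> inv \<rho>" using m by (simp add: m_assoc)
    also have "\<dots> = \<rho>' \<otimes> inv \<rho>" unfolding that(5) using m by (simp add: m_assoc[symmetric])
    finally have eq: "inv c' \<otimes> c = \<rho>' \<otimes> inv \<rho>" .
    have "inv c' \<otimes> c \<in> C" using that by (intro subgroup.m_closed[OF C] subgroup.m_inv_closed[OF C])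
    moreover have "inv c' \<otimes> c \<in> R" unfolding eq
      using that by (intro subgroup.m_closed[OF R] subgroup.m_inv_closed[OF R])
    ultimately have "inv c' \<otimes> c = \<one>" using meet by blast
    moreover have "c = c' \<otimes> (inv c' \<otimes> c)" using m by (simp add: m_assoc[symmetric])
    ultimately show ?thesis using m by simp
  qed
  define \<pi> where "\<pi> x = (SOME c. c \<in> C \<and> (\<exists>\<rho>\<in>R. x = c \<otimes> \<rho>))" for x
  have \<pi>: "\<pi> (c \<otimes> \<rho>) = c" if "c \<in> C" "\<rho> \<in> R" for c \<rho>
  proof -
    have "\<exists>c'. c' \<in> C \<and> (\<exists>\<rho>'\<in>R. c \<otimes> \<rho> = c' \<otimes> \<rho>')" using that by blast
    then have "\<pi> (c \<otimes> \<rho>) \<in> C \<and> (\<exists>\<rho>'\<in>R. c \<otimes> \<rho> = \<pi> (c \<otimes> \<rho>) \<otimes> \<rho>')"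
      unfolding \<pi>_def by (rule someI_ex)
    then obtain \<rho>' where "\<pi> (c \<otimes> \<rho>) \<in> C" "\<rho>' \<in> R" "c \<otimes> \<rho> = \<pi> (c \<otimes> \<rho>) \<otimes> \<rho>'" by blast
    then show ?thesis using unique[of "\<pi> (c \<otimes> \<rho>)" c \<rho>' \<rho>] that by simp
  qed
  have split: "\<exists>c\<in>C. \<exists>\<rho>\<in>R. x = c \<otimes> \<rho>" if "x \<in> carrier G" for x
    using that unfolding span[symmetric] set_mult_def by blast
  have in_C: "\<pi> x \<in> C" if "x \<in> carrier G" for x
    using split[OF that] \<pi> by auto
  have "\<pi> \<in> hom G G"
  proof (rule homI)
    show "\<pi> x \<in> carrier G" if "x \<in> carrier G" for x using in_C[OF that] Cc by blast
    show "\<pi> (x \<otimes> y) = \<pi> x \<otimes> \<pi> y" if x: "x \<in> carrier G" and y: "y \<in> carrier G" for x y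
    proof -
      obtain c \<rho> where c: "c \<in> C" "\<rho> \<in> R" "x = c \<otimes> \<rho>" using split[OF x] by blast
      obtain c' \<rho>' where c': "c' \<in> C" "\<rho>' \<in> R" "y = c' \<otimes> \<rho>'" using split[OF y] by blast
      have "x \<otimes> y = (c \<otimes> c') \<otimes> (\<rho> \<otimes> \<rho>')"
        using c c' Cc Rc by (simp add: m_ac)
      then show ?thesis
        using c c' \<pi> subgroup.m_closed[OF C, of c c'] subgroup.m_closed[OF R, of \<rho> \<rho>'] by simp
    qed
  qed
  then show thesis using that in_C \<pi> by blast
qed

theorem divisible_direct_sum:
  assumes div: "divisible (carrier G)"
  obtains \<F> r p where "countable_direct_sum G \<F> r (\<lambda>C. C) p"
proof -
  obtain \<F> where \<F>: "direct_divisible_family \<F>" and span: "generate G (\<Union>\<F>) = carrier G"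
    using direct_divisible_family_span[OF div] by blast
  have good: "subgroup C G" "countable C" "divisible C" "C \<noteq> {\<one>}" if "C \<in> \<F>" for C
    using \<F> that unfolding direct_divisible_family_def by blast+
  define R where "R C = generate G (\<Union>(\<F> - {C}))" for C
  have carr: "\<Union>\<G> \<subseteq> carrier G" if "\<G> \<subseteq> \<F>" for \<G>
    using that subgroup.subset[OF good(1)] by blast
  have R: "subgroup (R C) G" for C unfolding R_def by (rule generate_is_subgroup) (rule carr, blast)
  have "\<exists>\<pi>. \<pi> \<in> hom G G \<and> (\<forall>x\<in>carrier G. \<pi> x \<in> C) \<and> (\<forall>c\<in>C. \<forall>\<rho>\<in>R C. \<pi> (c \<otimes> \<rho>) = c)"
    if C: "C \<in> \<F>" for C
  proof -
    have "insert C (\<F> - {C}) = \<F>" using C by blast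
    then have "C <#> R C = carrier G"
      using generate_insert_subgroup[OF good(1)[OF C], of "\<F> - {C}"] carr[of "\<F> - {C}"] span
      unfolding R_def by auto
    moreover have "C \<inter> R C = {\<one>}"
      using \<F> C unfolding direct_divisible_family_def independent_family_def R_def by blast
    ultimately show ?thesis
      using projection_along_complement[OF good(1)[OF C] R] by metis
  qed
  then obtain p where p: "\<And>C. C \<in> \<F> \<Longrightarrow> p C \<in> hom G G"
      "\<And>C x. C \<in> \<F> \<Longrightarrow> x \<in> carrier G \<Longrightarrow> p C x \<in> C"
      "\<And>C c \<rho>. C \<in> \<F> \<Longrightarrow> c \<in> C \<Longrightarrow> \<rho> \<in> R C \<Longrightarrow> p C (c \<otimes> \<rho>) = c"
    by metis
  have p_R: "p C \<rho> = \<one>" if "C \<in> \<F>" "\<rho> \<in> R C" for C \<rho>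
    using p(3)[OF that(1) subgroup.one_closed[OF good(1)[OF that(1)]] that(2)]
      subgroup.mem_carrier[OF R that(2)] by simp
  have in_R: "generate G (\<Union>S) \<subseteq> R C" if "S \<subseteq> \<F>" "C \<notin> S" for S C
    unfolding R_def using that by (intro mono_generate) blast
  have finite_part: "\<exists>S. finite S \<and> S \<subseteq> \<F> \<and> x \<in> generate G (\<Union>S)" if "x \<in> carrier G" for x
    using generate_finite_support[of x \<F>] that span by simp
  have trivial: "x = \<one>"
    if "finite S" "S \<subseteq> \<F>" "x \<in> generate G (\<Union>S)" "\<And>C. C \<in> \<F> \<Longrightarrow> p C x = \<one>" for S x
    using that
  proof (induction S arbitrary: x rule: finite_induct)
    case empty
    then show ?case using generate_empty by simp
  next
    case (insert C S)
    have C: "C \<in> \<F>" using insert.prems by blast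
    have "x \<in> C <#> generate G (\<Union>S)"
      using insert.prems generate_insert_subgroup[OF good(1)[OF C] carr[of S]] by auto
    then obtain c d where cd: "c \<in> C" "d \<in> generate G (\<Union>S)" "x = c \<otimes> d"
      unfolding set_mult_def by blast
    have d: "d \<in> R C" using in_R[of S C] insert cd by blast
    have "c = \<one>" using p(3)[OF C cd(1) d] insert.prems(3)[OF C] cd(3) by simp
    then have "x = d" using cd subgroup.mem_carrier[OF R d] by simp
    then show ?case using insert.IH[of x] insert.prems cd(2) by blast
  qed
  obtain r where r: "well_order_on \<F> r" using well_order_on by blast
  have "countable_direct_sum G \<F> r (\<lambda>C. C) p"
  proof (rule countable_direct_sum.intro[OF comm_group_axioms countable_direct_sum_axioms.intro])
    show "well_order_on \<F> r" by (rule r)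
    show "subgroup C G" "countable C" if "C \<in> \<F>" for C using good that by auto
    show "infinite C" if "C \<in> \<F>" for C using divisible_infinite good that by blast
    show "p C \<in> hom G G" if "C \<in> \<F>" for C using p that by blast
    show "p C x \<in> C" if "C \<in> \<F>" "x \<in> carrier G" for C x using p that by blast
    show "p C u = u" if "C \<in> \<F>" "u \<in> C" for C u
      using p(3)[OF that subgroup.one_closed[OF R]] subgroup.mem_carrier[OF good(1)[OF that(1)] that(2)]
      by simp
    show "p B u = \<one>" if "C \<in> \<F>" "B \<in> \<F>" "B \<noteq> C" "u \<in> C" for B C u
    proof -
      have "u \<in> R B" unfolding R_def using that by (blast intro: generate.incl)
      then show ?thesis using p_R that by blast
    qed
    show "finite {C \<in> \<F>. p C x \<noteq> \<one>}" if x: "x \<in> carrier G" for x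
    proof -
      obtain S where S: "finite S" "S \<subseteq> \<F>" "x \<in> generate G (\<Union>S)" using finite_part[OF x] by blast
      have "{C \<in> \<F>. p C x \<noteq> \<one>} \<subseteq> S" using in_R S p_R by blast
      then show ?thesis using S(1) finite_subset by blast
    qed
    show "x = \<one>" if x: "x \<in> carrier G" "\<And>C. C \<in> \<F> \<Longrightarrow> p C x = \<one>" for x
      using finite_part[OF x(1)] trivial x(2) by blast
  qed
  then show thesis using that by blast
qed

theorem divisible_natural:
  assumes div: "divisible (carrier G)"
  shows "natural_group G"
proof -
  obtain \<F> r p where "countable_direct_sum G \<F> r (\<lambda>C. C) p"
    using divisible_direct_sum[OF div] by blast
  then interpret countable_direct_sum G \<F> r "\<lambda>C. C" p .
  show ?thesis
  proof (rule natural_if_square_roots)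
    fix x assume x: "x \<in> carrier G"
    obtain y where "y \<in> carrier G" "y [^] (2::nat) = x"
      using divisibleE[OF div x, of 2] by auto
    then show "\<exists>y\<in>carrier G. y \<otimes> y = x" by (auto simp: numeral_2_eq_2)
  qed
qed
end

section \<open>Strict derivatives\<close>

text \<open>
Strict differentiability: near \<open>p\<close> the remainder is Lipschitz with arbitrarily small constant. A
condition at a single point thus suffices for the fixed point argument below, and it is stable under
composition.
\<close>

definition has_strict_derivative ::
    "('e::real_normed_vector \<Rightarrow> 'f::real_normed_vector) \<Rightarrow> ('e \<Rightarrow> 'f) \<Rightarrow> 'e \<Rightarrow> bool" where
  "has_strict_derivative F L p \<longleftrightarrow> bounded_linear L \<and>
     (\<forall>e>0. \<exists>d>0. \<forall>x\<in>ball p d. \<forall>y\<in>ball p d. norm (F x - F y - L (x - y)) \<le> e * norm (x - y))"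

lemma has_strict_derivative_bounded_linear: "has_strict_derivative F L p \<Longrightarrow> bounded_linear L"
  by (simp add: has_strict_derivative_def)

lemma has_strict_derivativeE:
  assumes "has_strict_derivative F L p" "e > 0"
  obtains d where "d > 0"
    "\<And>x y. x \<in> ball p d \<Longrightarrow> y \<in> ball p d \<Longrightarrow> norm (F x - F y - L (x - y)) \<le> e * norm (x - y)"
  using assms unfolding has_strict_derivative_def by meson

lemma has_strict_derivative_imp_has_derivative:
  assumes F: "has_strict_derivative F L p"
  shows "(F has_derivative L) (at p)"
  unfolding has_derivative_within_alt
proof (intro conjI allI impI)
  show "bounded_linear L" by (rule has_strict_derivative_bounded_linear[OF F])
  fix e :: real assume e: "e > 0"
  obtain d where d: "d > 0"
    "\<And>x y. x \<in> ball p d \<Longrightarrow> y \<in> ball p d \<Longrightarrow> norm (F x - F y - L (x - y)) \<le> e * norm (x - y)"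
    using has_strict_derivativeE[OF F e] by blast
  show "\<exists>d>0. \<forall>y\<in>UNIV. norm (y - p) < d \<longrightarrow> norm (F y - F p - L (y - p)) \<le> e * norm (y - p)"
    using d by (intro exI[of _ d]) (auto simp: dist_norm norm_minus_commute)
qed

lemma has_strict_derivative_unique:
  "has_strict_derivative F L p \<Longrightarrow> has_strict_derivative F M p \<Longrightarrow> L = M"
  by (rule has_derivative_unique) (auto intro: has_strict_derivative_imp_has_derivative)

lemma has_strict_derivative_isCont: "has_strict_derivative F L p \<Longrightarrow> isCont F p"
  using has_strict_derivative_imp_has_derivative has_derivative_continuous by blast

lemma has_strict_derivative_cong:
  assumes F: "has_strict_derivative F L p" and r: "r > 0" and eq: "\<And>x. x \<in> ball p r \<Longrightarrow> F x = H x"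
  shows "has_strict_derivative H L p"
  unfolding has_strict_derivative_def
proof (intro conjI allI impI)
  show "bounded_linear L" by (rule has_strict_derivative_bounded_linear[OF F])
  fix e :: real assume e: "e > 0"
  obtain d where d: "d > 0"
    "\<And>x y. x \<in> ball p d \<Longrightarrow> y \<in> ball p d \<Longrightarrow> norm (F x - F y - L (x - y)) \<le> e * norm (x - y)"
    using has_strict_derivativeE[OF F e] by blast
  show "\<exists>d>0. \<forall>x\<in>ball p d. \<forall>y\<in>ball p d. norm (H x - H y - L (x - y)) \<le> e * norm (x - y)"
  proof (intro exI conjI ballI)
    show "min d r > 0" using d r by simp
    fix x y assume xy: "x \<in> ball p (min d r)" "y \<in> ball p (min d r)"
    then have "F x = H x" "F y = H y" using eq by auto
    then show "norm (H x - H y - L (x - y)) \<le> e * norm (x - y)" using d(2)[of x y] xy by simp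
  qed
qed

lemma has_strict_derivative_affine:
  "bounded_linear L \<Longrightarrow> has_strict_derivative (\<lambda>x. L x + c) L p"
  unfolding has_strict_derivative_def
  by (auto simp: linear_diff[OF bounded_linear.linear] intro: exI[of _ 1])

lemma has_strict_derivative_Pair:
  assumes F: "has_strict_derivative F L p" and H: "has_strict_derivative H M p"
  shows "has_strict_derivative (\<lambda>x. (F x, H x)) (\<lambda>v. (L v, M v)) p"
  unfolding has_strict_derivative_def
proof (intro conjI allI impI)
  show "bounded_linear (\<lambda>v. (L v, M v))"
    by (intro bounded_linear_Pair has_strict_derivative_bounded_linear[OF F]
        has_strict_derivative_bounded_linear[OF H])
  fix e :: real assume e: "e > 0"
  then have e2: "e / 2 > 0" by simp
  obtain d1 where d1: "d1 > 0"
    "\<And>x y. x \<in> ball p d1 \<Longrightarrow> y \<in> ball p d1 \<Longrightarrow> norm (F x - F y - L (x - y)) \<le> e / 2 * norm (x - y)"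
    using has_strict_derivativeE[OF F e2] by blast
  obtain d2 where d2: "d2 > 0"
    "\<And>x y. x \<in> ball p d2 \<Longrightarrow> y \<in> ball p d2 \<Longrightarrow> norm (H x - H y - M (x - y)) \<le> e / 2 * norm (x - y)"
    using has_strict_derivativeE[OF H e2] by blast
  show "\<exists>d>0. \<forall>x\<in>ball p d. \<forall>y\<in>ball p d.
      norm ((F x, H x) - (F y, H y) - (L (x - y), M (x - y))) \<le> e * norm (x - y)"
  proof (intro exI conjI ballI)
    show "min d1 d2 > 0" using d1 d2 by simp
    fix x y assume xy: "x \<in> ball p (min d1 d2)" "y \<in> ball p (min d1 d2)"
    have "norm ((F x, H x) - (F y, H y) - (L (x - y), M (x - y)))
        \<le> norm (F x - F y - L (x - y)) + norm (H x - H y - M (x - y))"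
      using norm_Pair_le[of "F x - F y - L (x - y)" "H x - H y - M (x - y)"] by simp
    also have "\<dots> \<le> e / 2 * norm (x - y) + e / 2 * norm (x - y)"
      using xy by (intro add_mono d1(2) d2(2)) auto
    finally show "norm ((F x, H x) - (F y, H y) - (L (x - y), M (x - y))) \<le> e * norm (x - y)"
      by (simp add: field_simps)
  qed
qed

lemma has_strict_derivative_compose:
  assumes H: "has_strict_derivative H M p" and F: "has_strict_derivative F L (H p)"
  shows "has_strict_derivative (\<lambda>x. F (H x)) (\<lambda>v. L (M v)) p"
  unfolding has_strict_derivative_def
proof (intro conjI allI impI)
  have bL: "bounded_linear L" and bM: "bounded_linear M"
    using F H has_strict_derivative_bounded_linear by blast+
  then show "bounded_linear (\<lambda>v. L (M v))" by (rule bounded_linear_compose)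
  fix e :: real assume e: "e > 0"
  obtain B where B: "B > 0" "\<And>v. norm (L v) \<le> norm v * B" using bounded_linear.pos_bounded[OF bL] by blast
  obtain K where K: "K > 0" "\<And>v. norm (M v) \<le> norm v * K" using bounded_linear.pos_bounded[OF bM] by blast
  \<comment> \<open>Half of the error comes from \<open>F\<close> along increments of \<open>H\<close>, half from \<open>L\<close> applied to the error of \<open>H\<close>.\<close>
  define e1 where "e1 = e / (2 * (K + 1))"
  define e2 where "e2 = min 1 (e / (2 * B))"
  have e12: "e1 > 0" "e2 > 0" "e2 \<le> 1" using e B K by (auto simp: e1_def e2_def)
  obtain d1 where d1: "d1 > 0" "\<And>x y. x \<in> ball (H p) d1 \<Longrightarrow> y \<in> ball (H p) d1 \<Longrightarrow>
      norm (F x - F y - L (x - y)) \<le> e1 * norm (x - y)"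
    using has_strict_derivativeE[OF F e12(1)] by blast
  obtain d2 where d2: "d2 > 0" "\<And>x y. x \<in> ball p d2 \<Longrightarrow> y \<in> ball p d2 \<Longrightarrow>
      norm (H x - H y - M (x - y)) \<le> e2 * norm (x - y)"
    using has_strict_derivativeE[OF H e12(2)] by blast
  obtain d3 where d3: "d3 > 0" "\<And>x. x \<in> ball p d3 \<Longrightarrow> H x \<in> ball (H p) d1"
  proof -
    from has_strict_derivative_isCont[OF H] d1(1)
    obtain d where "d > 0" "H ` ball p d \<subseteq> ball (H p) d1" by (auto simp only: continuous_at_ball)
    then show thesis using that by (meson imageI subsetD)
  qed
  show "\<exists>d>0. \<forall>x\<in>ball p d. \<forall>y\<in>ball p d.
      norm (F (H x) - F (H y) - L (M (x - y))) \<le> e * norm (x - y)"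
  proof (intro exI conjI ballI)
    show "min d2 d3 > 0" using d2 d3 by simp
    fix x y assume xy: "x \<in> ball p (min d2 d3)" "y \<in> ball p (min d2 d3)"
    let ?R = "H x - H y - M (x - y)"
    have R: "norm ?R \<le> e2 * norm (x - y)" using xy by (intro d2(2)) auto
    also have "\<dots> \<le> norm (x - y)" using e12 by (intro mult_left_le_one_le) auto
    finally have R1: "norm ?R \<le> norm (x - y)" .
    have "norm (H x - H y) \<le> norm ?R + norm (M (x - y))"
      using norm_triangle_ineq[of ?R "M (x - y)"] by simp
    also have "\<dots> \<le> (K + 1) * norm (x - y)" using R1 K(2)[of "x - y"] by (simp add: algebra_simps)
    finally have Hd: "norm (H x - H y) \<le> (K + 1) * norm (x - y)" .
    have "norm (F (H x) - F (H y) - L (H x - H y)) \<le> e1 * norm (H x - H y)"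
      using xy by (intro d1(2) d3(2)) auto
    also have "\<dots> \<le> e1 * ((K + 1) * norm (x - y))" using Hd e12 by (intro mult_left_mono) auto
    also have "\<dots> = e / 2 * norm (x - y)" using K by (simp add: e1_def field_simps)
    finally have 1: "norm (F (H x) - F (H y) - L (H x - H y)) \<le> e / 2 * norm (x - y)" .
    have "norm (L ?R) \<le> norm ?R * B" by (rule B(2))
    also have "\<dots> \<le> (e2 * norm (x - y)) * B" using R B by (intro mult_right_mono) auto
    also have "\<dots> \<le> (e / (2 * B) * norm (x - y)) * B"
      using B by (intro mult_right_mono) (auto simp: e2_def)
    also have "\<dots> = e / 2 * norm (x - y)" using B by simp
    finally have 2: "norm (L ?R) \<le> e / 2 * norm (x - y)" .
    have "F (H x) - F (H y) - L (M (x - y)) = (F (H x) - F (H y) - L (H x - H y)) + L ?R"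
      by (simp add: linear_diff[OF bounded_linear.linear[OF bL]])
    then have "norm (F (H x) - F (H y) - L (M (x - y))) \<le>
        norm (F (H x) - F (H y) - L (H x - H y)) + norm (L ?R)"
      by (simp only: norm_triangle_ineq)
    then show "norm (F (H x) - F (H y) - L (M (x - y))) \<le> e * norm (x - y)"
      using 1 2 by simp
  qed
qed

text \<open>
The second derivative makes the first one continuous at \<open>p\<close> in operator norm, and the mean value
inequality turns this into strict differentiability.
\<close>

lemma smooth_on_has_strict_derivative:
  assumes f: "smooth_on S f" and p: "p \<in> S"
  shows "\<exists>L. has_strict_derivative f L p"
proof -
  have S: "open S" using f by (simp add: smooth_on_def)
  from conjunct2[OF f[unfolded smooth_on_def]] obtain D where D:
    "(\<forall>x\<in>S. D 0 x [] = f x) \<and> (\<forall>n. \<forall>x\<in>S. bounded_multilinear n (D n x)) \<and>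
     (\<forall>n. \<forall>x\<in>S. \<forall>e>0. \<forall>\<^sub>F y in at x. \<forall>vs. length vs = n \<longrightarrow>
        norm (D n y vs - D n x vs - D (Suc n) x ((y - x) # vs))
          \<le> e * norm (y - x) * prod_list (map norm vs))"
    by (rule exE)
  have D0: "D 0 x [] = f x" if "x \<in> S" for x using D that by simp
  have ml: "bounded_multilinear n (D n x)" if "x \<in> S" for n x using D that by simp
  have der: "\<forall>\<^sub>F y in at x. \<forall>vs. length vs = n \<longrightarrow>
      norm (D n y vs - D n x vs - D (Suc n) x ((y - x) # vs))
        \<le> e * norm (y - x) * prod_list (map norm vs)" if "x \<in> S" "e > 0" for n x e
    using D that by simp
  define f' where "f' x v = D 1 x [v]" for x v
  have bl: "bounded_linear (f' x)" if x: "x \<in> S" for x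
  proof -
    have "\<forall>vs i. length vs = 1 \<and> i < 1 \<longrightarrow> linear (\<lambda>v. D 1 x (vs[i := v]))"
      using ml[OF x, of 1] unfolding bounded_multilinear_def by (rule conjunct1)
    from this[rule_format, of "[undefined]" 0] have lin: "linear (f' x)" by (simp add: f'_def[abs_def])
    obtain C where C: "\<And>vs. length vs = 1 \<Longrightarrow> norm (D 1 x vs) \<le> C * prod_list (map norm vs)"
      using ml[OF x, of 1] unfolding bounded_multilinear_def by blast
    have "norm (f' x v) \<le> norm v * C" for v using C[of "[v]"] by (simp add: f'_def mult.commute)
    then show ?thesis using lin by (simp add: bounded_linear_def bounded_linear_axioms_def) blast
  qed
  have has_der: "(f has_derivative f' x) (at x)" if x: "x \<in> S" for x
    unfolding has_derivative_within_alt2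
  proof (intro conjI allI impI)
    show "bounded_linear (f' x)" by (rule bl[OF x])
    fix e :: real assume e: "e > 0"
    have "\<forall>\<^sub>F y in at x. y \<in> S" using S x by (rule eventually_at_in_open')
    with der[OF x e, of 0] show "\<forall>\<^sub>F y in at x. norm (f y - f x - f' x (y - x)) \<le> e * norm (y - x)"
      by eventually_elim (use x in \<open>auto simp: D0 f'_def\<close>)
  qed
  \<comment> \<open>A bound of the second derivative at \<open>p\<close> controls the change of the first derivative.\<close>
  obtain C where C: "\<And>vs. length vs = 2 \<Longrightarrow> norm (D 2 p vs) \<le> C * prod_list (map norm vs)"
    using ml[OF p, of 2] unfolding bounded_multilinear_def by blast
  have "\<forall>\<^sub>F y in at p. y \<in> S \<and> (\<forall>v. norm (f' y v - f' p v) \<le> (1 + \<bar>C\<bar>) * norm (y - p) * norm v)"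
    using der[OF p zero_less_one, of 1] eventually_at_in_open'[OF S p]
  proof eventually_elim
    case (elim y)
    show ?case
    proof (intro conjI allI)
      fix v
      have "norm (D 1 y [v] - D 1 p [v] - D 2 p [y - p, v]) \<le> norm (y - p) * norm v"
        using elim(1)[rule_format, of "[v]"] by (simp add: numeral_2_eq_2)
      moreover have "norm (D 2 p [y - p, v]) \<le> C * (norm (y - p) * norm v)"
        using C[of "[y - p, v]"] by simp
      moreover have "C * (norm (y - p) * norm v) \<le> \<bar>C\<bar> * (norm (y - p) * norm v)"
        by (intro mult_right_mono) auto
      moreover have "norm (D 1 y [v] - D 1 p [v]) \<le>
         norm (D 1 y [v] - D 1 p [v] - D 2 p [y - p, v]) + norm (D 2 p [y - p, v])"
        using norm_triangle_ineq[of "D 1 y [v] - D 1 p [v] - D 2 p [y - p, v]" "D 2 p [y - p, v]"] by simp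
      ultimately show "norm (f' y v - f' p v) \<le> (1 + \<bar>C\<bar>) * norm (y - p) * norm v"
        by (simp add: f'_def algebra_simps)
    qed (use elim in simp)
  qed
  then obtain d0 where d0: "d0 > 0" "\<And>y. y \<noteq> p \<Longrightarrow> dist y p < d0 \<Longrightarrow> y \<in> S \<and>
      (\<forall>v. norm (f' y v - f' p v) \<le> (1 + \<bar>C\<bar>) * norm (y - p) * norm v)"
    unfolding eventually_at by auto
  have "has_strict_derivative f (f' p) p"
    unfolding has_strict_derivative_def
  proof (intro conjI allI impI)
    show "bounded_linear (f' p)" by (rule bl[OF p])
    fix e :: real assume e: "e > 0"
    define d where "d = min d0 (e / (1 + \<bar>C\<bar>))"
    have d: "d > 0" using d0 e by (simp add: d_def)
    have near: "y \<in> S \<and> onorm (f' y - f' p) \<le> e" if y: "y \<in> ball p d" for y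
    proof (cases "y = p")
      case True
      then have "norm ((f' y - f' p) v) \<le> e * norm v" for v using e by simp
      then have "onorm (f' y - f' p) \<le> e" using e by (intro onorm_bound) auto
      then show ?thesis using True p by simp
    next
      case False
      have yd: "dist y p < d0" "norm (y - p) < e / (1 + \<bar>C\<bar>)"
        using y by (auto simp: d_def dist_norm norm_minus_commute)
      have "(1 + \<bar>C\<bar>) * norm (y - p) \<le> e" using yd(2) by (simp add: field_simps)
      then have "(1 + \<bar>C\<bar>) * norm (y - p) * norm v \<le> e * norm v" for v
        by (intro mult_right_mono) auto
      then have "norm ((f' y - f' p) v) \<le> e * norm v" for v
        using d0(2)[OF False yd(1)] order_trans unfolding fun_diff_def by blast
      then have "onorm (f' y - f' p) \<le> e" using e by (intro onorm_bound) auto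
      then show ?thesis using d0(2)[OF False yd(1)] by simp
    qed
    show "\<exists>d>0. \<forall>x\<in>ball p d. \<forall>y\<in>ball p d. norm (f x - f y - f' p (x - y)) \<le> e * norm (x - y)"
    proof (intro exI[of _ d] conjI ballI)
      fix x y assume x: "x \<in> ball p d" and y: "y \<in> ball p d"
      have "norm (f x - f y - f' p (x - y)) \<le> norm (x - y) * e"
      proof (rule differentiable_bound_linearization)
        show "y + t *\<^sub>R (x - y) \<in> ball p d" if "t \<in> {0..1}" for t
        proof -
          have "(1 - t) *\<^sub>R y + t *\<^sub>R x \<in> ball p d"
            using convex_ball[of p d] x y that by (intro convexD) auto
          then show ?thesis by (simp add: algebra_simps)
        qed
        show "(f has_derivative f' z) (at z within ball p d)" if "z \<in> ball p d" for z
          using has_der near[OF that] has_derivative_at_withinI by blast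
        show "onorm (f' z - f' p) \<le> e" if "z \<in> ball p d" for z using near[OF that] by blast
        show "p \<in> ball p d" using d by simp
      qed
      then show "norm (f x - f y - f' p (x - y)) \<le> e * norm (x - y)" by (simp add: mult.commute)
    qed (rule d)
  qed
  then show ?thesis by blast
qed

text \<open>
The surjectivity part of the inverse function theorem: \<open>F x = y\<close> says that \<open>x\<close> is a fixed point of
\<open>x \<mapsto> x - (F x - y) / c\<close>, which is a contraction of a small closed ball for \<open>y\<close> close to \<open>F p\<close>.
\<close>

lemma strict_scaling_locally_onto:
  fixes F :: "'e::banach \<Rightarrow> 'e"
  assumes F: "has_strict_derivative F (\<lambda>v. c *\<^sub>R v) p" and c: "c > 0" and d: "d > 0"
  shows "\<exists>r>0. ball (F p) r \<subseteq> F ` ball p d"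
proof -
  obtain d1 where d1: "d1 > 0" "\<And>x y. x \<in> ball p d1 \<Longrightarrow> y \<in> ball p d1 \<Longrightarrow>
      norm (F x - F y - c *\<^sub>R (x - y)) \<le> c / 2 * norm (x - y)"
    using has_strict_derivativeE[OF F, of "c / 2"] c by auto
  define \<delta> where "\<delta> = min d d1 / 2"
  have \<delta>: "\<delta> > 0" "\<delta> < d" "\<delta> < d1" using d d1 by (auto simp: \<delta>_def min_def)
  show ?thesis
  proof (intro exI conjI subsetI)
    show "c * \<delta> / 2 > 0" using c \<delta> by simp
    fix y assume y: "y \<in> ball (F p) (c * \<delta> / 2)"
    define t where "t x = x - (1 / c) *\<^sub>R (F x - y)" for x
    have contr: "dist (t x) (t z) \<le> 1 / 2 * dist x z" if "x \<in> cball p \<delta>" "z \<in> cball p \<delta>" for x z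
    proof -
      have "t x - t z = - ((1 / c) *\<^sub>R (F x - F z - c *\<^sub>R (x - z)))"
        using c by (simp add: t_def algebra_simps)
      then have "norm (t x - t z) = 1 / c * norm (F x - F z - c *\<^sub>R (x - z))"
        using c by simp
      also have "\<dots> \<le> 1 / c * (c / 2 * norm (x - z))"
        using c that \<delta> by (intro mult_left_mono d1(2)) auto
      finally show ?thesis using c by (simp add: dist_norm)
    qed
    have "norm (F p - y) < c * \<delta> / 2" using y by (simp add: dist_norm)
    then have "norm (F p - y) / c < \<delta> / 2" using c by (simp add: field_simps)
    moreover have "dist (t p) p = norm (F p - y) / c" using c by (simp add: t_def dist_norm)
    ultimately have "dist (t p) p \<le> \<delta> / 2" by simp
    then have maps: "t x \<in> cball p \<delta>" if x: "x \<in> cball p \<delta>" for x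
      using contr[OF x, of p] \<delta> x dist_triangle[of p "t x" "t p"] by (simp add: dist_commute)
    have "\<exists>!x\<in>cball p \<delta>. t x = x"
      by (rule Banach_fix[of _ "1 / 2"]) (use \<delta> maps contr in \<open>auto simp: complete_eq_closed\<close>)
    then obtain x where x: "x \<in> cball p \<delta>" "t x = x" by blast
    then have "F x = y" using c by (simp add: t_def)
    then show "y \<in> F ` ball p d" using x \<delta> by auto
  qed
qed

section \<open>Powers in a connected Banach-Lie group\<close>

text \<open>
In the chart, multiplication \<open>\<mu>\<close> satisfies \<open>\<mu> (x, p) = x = \<mu> (p, x)\<close> near the point \<open>p\<close> of the identity, so
its derivative at \<open>(p, p)\<close> is addition. The claim follows by induction from
\<open>x\<^sup>n\<^sup>+\<^sup>1 = \<mu> (x\<^sup>n, x)\<close> and the chain rule; the neighbourhood has to be shrunk in every step for the powers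
to stay in the domain of the chart.
\<close>

lemma power_map_in_chart:
  fixes G :: "('a, 'b) monoid_scheme" and A :: "('a, 'e::banach) chart set"
  assumes lie: "banach_lie_group G T A" and chart: "(U, \<phi>) \<in> A" "\<one>\<^bsub>G\<^esub> \<in> U"
  shows "\<exists>d>0. (\<forall>x\<in>ball (\<phi> \<one>\<^bsub>G\<^esub>) d. x \<in> \<phi> ` U \<and> inv_into U \<phi> x [^]\<^bsub>G\<^esub> n \<in> U) \<and>
     has_strict_derivative (\<lambda>x. \<phi> (inv_into U \<phi> x [^]\<^bsub>G\<^esub> (n::nat))) (\<lambda>v. real n *\<^sub>R v) (\<phi> \<one>\<^bsub>G\<^esub>)"
proof -
  interpret group G using lie by (simp add: banach_lie_group_def)
  define p where "p = \<phi> \<one>\<^bsub>G\<^esub>"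
  define q where "q = inv_into U \<phi>"
  define V where "V = {(x, y). x \<in> U \<and> y \<in> U \<and> x \<otimes>\<^bsub>G\<^esub> y \<in> U}"
  define W where "W = map_prod \<phi> \<phi> ` V"
  define \<mu> where "\<mu> = (\<lambda>(x, y). \<phi> (q x \<otimes>\<^bsub>G\<^esub> q y))"
  have mfd: "banach_manifold T A" and topsp: "topspace T = carrier G"
    using lie by (auto simp: banach_lie_group_def)
  have UT: "openin T U" and op: "open (\<phi> ` U)"
    and hom: "homeomorphic_map (subtopology T U) (top_of_set (\<phi> ` U)) \<phi>"
    using mfd chart(1) unfolding banach_manifold_def by blast+
  have UG: "U \<subseteq> carrier G" using openin_subset[OF UT] topsp by simp
  have inj: "inj_on \<phi> U"
    using homeomorphic_imp_injective_map[OF hom] UG topsp by (simp add: Int_absorb1)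
  have q\<phi>: "q (\<phi> a) = a" if "a \<in> U" for a using inj that by (simp add: q_def)
  have pU: "p \<in> \<phi> ` U" and qp: "q p = \<one>\<^bsub>G\<^esub>" using chart(2) q\<phi> by (auto simp: p_def)
  have smooth: "smooth_map (prod_topology T T) (prod_atlas A A) T A (\<lambda>(x, y). x \<otimes>\<^bsub>G\<^esub> y)"
    using lie by (simp add: banach_lie_group_def)
  have "(U \<times> U, map_prod \<phi> \<phi>) \<in> prod_atlas A A" using chart(1) unfolding prod_atlas_def by blast
  then have sm: "smooth_on (map_prod \<phi> \<phi> ` {x \<in> U \<times> U. (\<lambda>(x, y). x \<otimes>\<^bsub>G\<^esub> y) x \<in> U})
      (\<phi> \<circ> (\<lambda>(x, y). x \<otimes>\<^bsub>G\<^esub> y) \<circ> inv_into (U \<times> U) (map_prod \<phi> \<phi>))"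
    using smooth chart(1) unfolding smooth_map_def by blast
  moreover have "{x \<in> U \<times> U. (\<lambda>(x, y). x \<otimes>\<^bsub>G\<^esub> y) x \<in> U} = V" by (auto simp: V_def)
  ultimately have sm: "smooth_on W (\<phi> \<circ> (\<lambda>(x, y). x \<otimes>\<^bsub>G\<^esub> y) \<circ> inv_into (U \<times> U) (map_prod \<phi> \<phi>))"
    by (simp add: W_def)
  then have openW: "open W" by (simp add: smooth_on_def)
  have W_E: "\<exists>a b. (a, b) \<in> V \<and> z = (\<phi> a, \<phi> b)" if "z \<in> W" for z
    using that unfolding W_def by auto
  have \<mu>_eq: "(\<phi> \<circ> (\<lambda>(x, y). x \<otimes>\<^bsub>G\<^esub> y) \<circ> inv_into (U \<times> U) (map_prod \<phi> \<phi>)) z = \<mu> z" if "z \<in> W" for z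
  proof -
    obtain a b where ab: "(a, b) \<in> V" "z = (\<phi> a, \<phi> b)" using W_E[OF \<open>z \<in> W\<close>] by blast
    have "inj_on (map_prod \<phi> \<phi>) (U \<times> U)" using inj by (rule map_prod_inj_on[OF _ inj])
    then have "inv_into (U \<times> U) (map_prod \<phi> \<phi>) (map_prod \<phi> \<phi> (a, b)) = (a, b)"
      using ab by (intro inv_into_f_f) (auto simp: V_def)
    then show ?thesis using ab by (simp add: \<mu>_def q\<phi> V_def)
  qed
  have ppW: "(p, p) \<in> W"
  proof -
    have "(\<one>\<^bsub>G\<^esub>, \<one>\<^bsub>G\<^esub>) \<in> V" using chart(2) by (simp add: V_def)
    then have "map_prod \<phi> \<phi> (\<one>\<^bsub>G\<^esub>, \<one>\<^bsub>G\<^esub>) \<in> W" unfolding W_def by (rule imageI)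
    then show ?thesis by (simp add: p_def)
  qed
  obtain M where M: "has_strict_derivative
      (\<phi> \<circ> (\<lambda>(x, y). x \<otimes>\<^bsub>G\<^esub> y) \<circ> inv_into (U \<times> U) (map_prod \<phi> \<phi>)) M (p, p)"
    using smooth_on_has_strict_derivative[OF sm ppW] by blast
  obtain r where r: "r > 0" "ball (p, p) r \<subseteq> W"
    using openW ppW unfolding open_contains_ball by blast
  have \<mu>_der: "has_strict_derivative \<mu> M (p, p)"
    by (rule has_strict_derivative_cong[OF M r(1)]) (rule \<mu>_eq, rule subsetD[OF r(2)])
  obtain s where s: "s > 0" "ball p s \<subseteq> \<phi> ` U" using op pU unfolding open_contains_ball by blast
  have const: "has_strict_derivative (\<lambda>x. p) (\<lambda>v. 0) x" for x :: 'e
    using has_strict_derivative_affine[of "\<lambda>v. 0" p x] by (simp add: bounded_linear_zero)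
  have ident: "has_strict_derivative (\<lambda>x. x) (\<lambda>v. v) x" for x :: 'e
    using has_strict_derivative_affine[of "\<lambda>v. v" 0 x] by (simp add: bounded_linear_ident)
  \<comment> \<open>One factor being the identity determines the two partial derivatives of \<open>\<mu>\<close>.\<close>
  have \<mu>_unit: "\<mu> (x, p) = x" "\<mu> (p, x) = x" if "x \<in> ball p s" for x
  proof -
    obtain a where "a \<in> U" "x = \<phi> a" using \<open>x \<in> ball p s\<close> s by blast
    then show "\<mu> (x, p) = x" "\<mu> (p, x) = x" using UG by (auto simp: \<mu>_def qp q\<phi>)
  qed
  have "has_strict_derivative (\<lambda>x. \<mu> (x, p)) (\<lambda>v. M (v, 0)) p"
    by (rule has_strict_derivative_compose[OF has_strict_derivative_Pair[OF ident const] \<mu>_der])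
  then have "has_strict_derivative (\<lambda>x. x) (\<lambda>v. M (v, 0)) p"
    by (rule has_strict_derivative_cong[OF _ s(1)]) (simp add: \<mu>_unit)
  then have "(\<lambda>v. M (v, 0)) = (\<lambda>v. v)" by (rule has_strict_derivative_unique[OF _ ident])
  then have M1: "M (v, 0) = v" for v by (rule fun_cong)
  have "has_strict_derivative (\<lambda>x. \<mu> (p, x)) (\<lambda>v. M (0, v)) p"
    by (rule has_strict_derivative_compose[OF has_strict_derivative_Pair[OF const ident] \<mu>_der])
  then have "has_strict_derivative (\<lambda>x. x) (\<lambda>v. M (0, v)) p"
    by (rule has_strict_derivative_cong[OF _ s(1)]) (simp add: \<mu>_unit)
  then have "(\<lambda>v. M (0, v)) = (\<lambda>v. v)" by (rule has_strict_derivative_unique[OF _ ident])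
  then have M2: "M (0, v) = v" for v by (rule fun_cong)
  have M_sum: "M (u, v) = u + v" for u v
  proof -
    have "linear M" using has_strict_derivative_bounded_linear[OF \<mu>_der] by (rule bounded_linear.linear)
    then have "M ((u, 0) + (0, v)) = M (u, 0) + M (0, v)" by (rule linear_add)
    then show ?thesis by (simp add: M1 M2)
  qed
  have "\<exists>d>0. (\<forall>x\<in>ball p d. x \<in> \<phi> ` U \<and> q x [^]\<^bsub>G\<^esub> n \<in> U) \<and>
     has_strict_derivative (\<lambda>x. \<phi> (q x [^]\<^bsub>G\<^esub> n)) (\<lambda>v. real n *\<^sub>R v) p"
  proof (induction n)
    case 0
    show ?case using s chart(2) const by (auto intro!: exI[of _ s] simp: p_def[symmetric])
  next
    case (Suc n)
    define P where "P x = \<phi> (q x [^]\<^bsub>G\<^esub> n)" for x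
    obtain d where d: "d > 0" "\<And>x. x \<in> ball p d \<Longrightarrow> x \<in> \<phi> ` U \<and> q x [^]\<^bsub>G\<^esub> n \<in> U"
      and P: "has_strict_derivative P (\<lambda>v. real n *\<^sub>R v) p"
      using Suc.IH unfolding P_def by blast
    have Pp: "P p = p" by (simp add: P_def qp p_def[symmetric])
    have pair: "has_strict_derivative (\<lambda>x. (P x, x)) (\<lambda>v. (real n *\<^sub>R v, v)) p"
      by (rule has_strict_derivative_Pair[OF P ident])
    obtain d' where d': "d' > 0" "\<And>x. x \<in> ball p d' \<Longrightarrow> (P x, x) \<in> ball (p, p) r"
    proof -
      have "isCont (\<lambda>x. (P x, x)) p" by (rule has_strict_derivative_isCont[OF pair])
      then obtain e where "e > 0" "(\<lambda>x. (P x, x)) ` ball p e \<subseteq> ball (P p, p) r"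
        using r(1) by (auto simp only: continuous_at_ball)
      then show thesis using that Pp by (auto simp: image_subset_iff)
    qed
    have step: "x \<in> \<phi> ` U \<and> q x [^]\<^bsub>G\<^esub> Suc n \<in> U \<and> \<mu> (P x, x) = \<phi> (q x [^]\<^bsub>G\<^esub> Suc n)"
      if x: "x \<in> ball p (min d d')" for x
    proof -
      have xU: "x \<in> \<phi> ` U" "q x [^]\<^bsub>G\<^esub> n \<in> U" using d(2)[of x] x by auto
      have "(P x, x) \<in> W" using d'(2)[of x] x r(2) by auto
      then obtain a b where ab: "(a, b) \<in> V" "P x = \<phi> a" "x = \<phi> b" using W_E by blast
      then have b: "q x = b" by (simp add: q\<phi> V_def)
      have "q (P x) = q x [^]\<^bsub>G\<^esub> n" using q\<phi>[OF xU(2)] by (simp add: P_def)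
      then have a: "a = q x [^]\<^bsub>G\<^esub> n" using ab by (simp add: q\<phi> V_def)
      show ?thesis using ab xU \<open>q (P x) = _\<close> unfolding a b[symmetric] by (simp add: V_def \<mu>_def)
    qed
    have "has_strict_derivative (\<lambda>x. \<mu> (P x, x)) (\<lambda>v. M (real n *\<^sub>R v, v)) p"
      using has_strict_derivative_compose[OF pair, of \<mu> M] \<mu>_der Pp by simp
    then have "has_strict_derivative (\<lambda>x. \<phi> (q x [^]\<^bsub>G\<^esub> Suc n)) (\<lambda>v. M (real n *\<^sub>R v, v)) p"
    proof (rule has_strict_derivative_cong)
      show "min d d' > 0" using d(1) d'(1) by simp
    qed (use step in blast)
    moreover have "M (real n *\<^sub>R v, v) = real (Suc n) *\<^sub>R v" for v
      by (simp add: M_sum algebra_simps)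
    ultimately have "has_strict_derivative (\<lambda>x. \<phi> (q x [^]\<^bsub>G\<^esub> Suc n)) (\<lambda>v. real (Suc n) *\<^sub>R v) p"
      by simp
    moreover have "min d d' > 0" using d d' by simp
    ultimately show ?case using step by blast
  qed
  then show ?thesis unfolding p_def q_def .
qed

text \<open>Every coset is open along with the subgroup, so the subgroup is also closed.\<close>

lemma (in group) open_subgroup_of_connected:
  assumes topsp: "topspace T = carrier G" and conn: "connected_space T"
    and cont: "\<And>c. c \<in> carrier G \<Longrightarrow> continuous_map T T (\<lambda>x. x \<otimes> c)"
    and H: "subgroup H G" and N: "openin T N" "\<one> \<in> N" "N \<subseteq> H"
  shows "H = carrier G"
proof -
  have nbhd: "openin T {x \<in> topspace T. x \<otimes> inv h \<in> N}" "h \<in> {x \<in> topspace T. x \<otimes> inv h \<in> N}"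
    if h: "h \<in> carrier G" for h
    using openin_continuous_map_preimage[OF cont[of "inv h"] N(1)] h N(2) topsp by auto
  have coset: "x \<in> H \<longleftrightarrow> h \<in> H" if "x \<in> carrier G" "h \<in> carrier G" "x \<otimes> inv h \<in> N" for x h
  proof -
    have xh: "x \<otimes> inv h \<in> H" using that N by blast
    have "x = (x \<otimes> inv h) \<otimes> h" "h = inv (x \<otimes> inv h) \<otimes> x"
      using that by (simp_all add: m_assoc inv_mult_group)
    then show ?thesis
      using xh subgroup.m_closed[OF H] subgroup.m_inv_closed[OF H xh] by metis
  qed
  have "openin T H"
  proof (subst openin_subopen, intro ballI)
    fix h assume h: "h \<in> H"
    then have hc: "h \<in> carrier G" using subgroup.mem_carrier[OF H] by blast
    show "\<exists>B. openin T B \<and> h \<in> B \<and> B \<subseteq> H"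
      using nbhd[OF hc] coset[OF _ hc] h topsp
      by (intro exI[of _ "{x \<in> topspace T. x \<otimes> inv h \<in> N}"]) auto
  qed
  moreover have "openin T (topspace T - H)"
  proof (subst openin_subopen, intro ballI)
    fix h assume h: "h \<in> topspace T - H"
    then have hc: "h \<in> carrier G" using topsp by blast
    show "\<exists>B. openin T B \<and> h \<in> B \<and> B \<subseteq> topspace T - H"
      using nbhd[OF hc] coset[OF _ hc] h topsp
      by (intro exI[of _ "{x \<in> topspace T. x \<otimes> inv h \<in> N}"]) auto
  qed
  then have "closedin T H"
    using subgroup.subset[OF H] topsp by (simp add: closedin_def)
  ultimately have "H = {} \<or> H = topspace T"
    using conn unfolding connected_space_clopen_in by blast
  then show ?thesis using subgroup.one_closed[OF H] topsp by blast
qed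

text \<open>
The \<open>n\<close>-th powers form a subgroup because the group is abelian, and they contain a neighbourhood of
the identity because the power map is locally onto.
\<close>

theorem connected_banach_lie_group_divisible:
  fixes G :: "('a, 'b) monoid_scheme" and A :: "('a, 'e::banach) chart set"
  assumes lie: "banach_lie_group G T A" and comm: "comm_group G" and conn: "connected_space T"
  shows "group.divisible G (carrier G)"
proof -
  interpret comm_group G by (rule comm)
  have topsp: "topspace T = carrier G" and mfd: "banach_manifold T A"
    using lie by (auto simp: banach_lie_group_def)
  have "\<one>\<^bsub>G\<^esub> \<in> topspace T" using topsp by simp
  then have "\<one>\<^bsub>G\<^esub> \<in> (\<Union>(U, \<phi>)\<in>A. U)" using mfd by (simp add: banach_manifold_def)
  then obtain U \<phi> where chart: "(U, \<phi>) \<in> A" "\<one>\<^bsub>G\<^esub> \<in> U" by blast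
  have UT: "openin T U" and hom: "homeomorphic_map (subtopology T U) (top_of_set (\<phi> ` U)) \<phi>"
    using mfd chart(1) unfolding banach_manifold_def by blast+
  have UG: "U \<subseteq> carrier G" using openin_subset[OF UT] topsp by simp
  have inj: "inj_on \<phi> U"
    using homeomorphic_imp_injective_map[OF hom] UG topsp by (simp add: Int_absorb1)
  have cont_mult: "continuous_map (prod_topology T T) T (\<lambda>(x, y). x \<otimes>\<^bsub>G\<^esub> y)"
    using lie by (simp add: banach_lie_group_def smooth_map_def)
  have cont: "continuous_map T T (\<lambda>x. x \<otimes>\<^bsub>G\<^esub> c)" if "c \<in> carrier G" for c
  proof -
    have "continuous_map T (prod_topology T T) (\<lambda>x. (x, c))"
      using that topsp by (intro continuous_map_pairedI) auto
    from continuous_map_compose[OF this cont_mult] show ?thesis by (simp add: o_def)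
  qed
  have "{y [^]\<^bsub>G\<^esub> n | y. y \<in> carrier G} = carrier G" if n: "n > 0" for n :: nat
  proof -
    have sub: "subgroup {y [^]\<^bsub>G\<^esub> n | y. y \<in> carrier G} G"
    proof (rule subgroupI)
      show "{y [^]\<^bsub>G\<^esub> n | y. y \<in> carrier G} \<subseteq> carrier G" "{y [^]\<^bsub>G\<^esub> n | y. y \<in> carrier G} \<noteq> {}"
        using one_closed by auto
      show "inv\<^bsub>G\<^esub> a \<in> {y [^]\<^bsub>G\<^esub> n | y. y \<in> carrier G}" if "a \<in> {y [^]\<^bsub>G\<^esub> n | y. y \<in> carrier G}" for a
        using that nat_pow_inv[symmetric] inv_closed by fastforce
      show "a \<otimes>\<^bsub>G\<^esub> b \<in> {y [^]\<^bsub>G\<^esub> n | y. y \<in> carrier G}"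
        if "a \<in> {y [^]\<^bsub>G\<^esub> n | y. y \<in> carrier G}" "b \<in> {y [^]\<^bsub>G\<^esub> n | y. y \<in> carrier G}" for a b
        using that nat_pow_distrib[symmetric] m_closed by fastforce
    qed
    let ?p = "\<phi> \<one>\<^bsub>G\<^esub>" and ?q = "inv_into U \<phi>"
    obtain d where d: "d > 0" "\<And>x. x \<in> ball ?p d \<Longrightarrow> x \<in> \<phi> ` U \<and> ?q x [^]\<^bsub>G\<^esub> n \<in> U"
      and der: "has_strict_derivative (\<lambda>x. \<phi> (?q x [^]\<^bsub>G\<^esub> n)) (\<lambda>v. real n *\<^sub>R v) ?p"
      using power_map_in_chart[OF lie chart, of n] by blast
    obtain s where s: "s > 0"
      "ball (\<phi> (?q ?p [^]\<^bsub>G\<^esub> n)) s \<subseteq> (\<lambda>x. \<phi> (?q x [^]\<^bsub>G\<^esub> n)) ` ball ?p d"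
      using strict_scaling_locally_onto[OF der _ d(1)] n by auto
    have qp: "?q ?p = \<one>\<^bsub>G\<^esub>" using inj chart(2) by simp
    let ?N = "{a \<in> topspace (subtopology T U). \<phi> a \<in> ball ?p s \<inter> \<phi> ` U}"
    have "openin (subtopology T U) ?N"
      using homeomorphic_imp_continuous_map[OF hom]
      by (rule openin_continuous_map_preimage) (auto simp: openin_open)
    then have N1: "openin T ?N" using UT openin_trans_full by blast
    have N2: "\<one>\<^bsub>G\<^esub> \<in> ?N" using chart UG topsp s(1) by auto
    have N3: "?N \<subseteq> {y [^]\<^bsub>G\<^esub> n | y. y \<in> carrier G}"
    proof
      fix a assume a: "a \<in> ?N"
      then have aU: "a \<in> U" and "\<phi> a \<in> ball ?p s" by auto
      then obtain x where x: "x \<in> ball ?p d" "\<phi> a = \<phi> (?q x [^]\<^bsub>G\<^esub> n)"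
        using s(2) unfolding qp by auto
      then have "a = ?q x [^]\<^bsub>G\<^esub> n" using inj aU d(2)[OF x(1)] by (auto dest: inj_onD)
      moreover have "?q x \<in> carrier G" using inv_into_into[of x \<phi> U] d(2)[OF x(1)] UG by auto
      ultimately show "a \<in> {y [^]\<^bsub>G\<^esub> n | y. y \<in> carrier G}" by blast
    qed
    show ?thesis by (rule open_subgroup_of_connected[OF topsp conn cont sub N1 N2 N3])
  qed
  note powers = this
  show ?thesis
    unfolding divisible_def
  proof (intro ballI allI impI)
    fix x and n :: nat assume "x \<in> carrier G" "n > 0"
    then have "x \<in> {y [^]\<^bsub>G\<^esub> n | y. y \<in> carrier G}" using powers by simp
    then show "\<exists>y\<in>carrier G. y [^]\<^bsub>G\<^esub> n = x" by blast
  qed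
qed

theorem corollary11:
  fixes G :: "('a, 'b) monoid_scheme"
    and T :: "'a topology"
    and A :: "('a, 'e::banach) chart set"
  assumes "banach_lie_group G T A"
    and "comm_group G"
    and "connected_space T"
  shows "natural_group G"
  using comm_group.divisible_natural[OF assms(2) connected_banach_lie_group_divisible[OF assms]] .

end
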